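(* The operator $R_\infty$ given by $$R_\infty=\frac{1}{c}\left(I-\gamma\left(A^{-1}-A^{-1}X\left(X^*A^{-1}X\right)^{-1}X^*A^{-1}\right)\right)$$ is the kernel operator of a reproducing kernel Hilbert space (RKHS) $\mathcal{H}_{R_\infty}$; that is, $R_\infty$ is the integral operator associated with a reproducing kernel $r_\infty:\Omega\times\Omega\to\mathbb{R}$, and $\mathcal{H}_{R_\infty}$ is the RKHS of $r_\infty$.
   Context: Let $c,\gamma$ be positive real constants. Let $\Omega$ be a compact domain equipped with a finite measure $\mu$, and let $\mathcal{L}^2(\Omega)=\mathcal{L}^2(\Omega,\mu)$, with inner product $\langle\cdot,\cdot\rangle$. Let $k:\Omega\times\Omega\to\mathbb{R}$ be a continuous, symmetric and positive-definite kernel with associated integral operator $Kf(s)=\int_\Omega k(s,t)f(t)\,d\mu(t)$; the operator $K:\mathcal{L}^2(\Omega)\to C(\Omega)$ is bounded, self-adjoint and positive. Let $x_1,\dots,x_p\in C(\Omega)$ be linearly independent, and let $X\beta=\sum_{j=1}^p\beta_jx_j$ for $\beta\in\mathbb{R}^p$; equivalently, $X:\mathbb{R}^p\to C(\Omega)$ is injective. It is not required that $\mathrm{span}\{x_1,\dots,x_p\}\subset\mathcal{H}_K$ or that $\mathrm{span}\{x_1,\dots,x_p\}\cap\mathcal{H}_K=\{0\}$, where $\mathcal{H}_K$ is the RKHS of $k$. The adjoint is $X^*h=(\langle h,x_j\rangle)_{j=1}^p$ for $h\in\mathcal{L}^2(\Omega)$. Set $A=cK+\gamma I$, where $I$ is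 the identity.
   Formalization: Added assumption: a combination of the x_j vanishing μ-almost everywhere vanishes on Ω; without it X*A⁻¹X need not be invertible (e.g. μ = δ_0 on [0,1], x_1(s) = s), so R_∞ would be undefined. *)

theory Defs
  imports "HOL-Analysis.Analysis"
begin

text \<open>
  The domain \<open>\<Omega>\<close> is \<open>space \<mu>\<close>. A real function on \<open>\<Omega>\<close> is represented by a function on the ambient
  type that vanishes off \<open>\<Omega>\<close>; kernels and the given \<open>x j\<close> may have any values off \<open>\<Omega>\<close>,
  which are never used.
\<close>

definition L2 :: "'a measure \<Rightarrow> ('a \<Rightarrow> real) set" where
  "L2 \<mu> = {f. f \<in> borel_measurable \<mu> \<and> integrable \<mu> (\<lambda>t. (f t)\<^sup>2) \<and> (\<forall>s. s \<notin> space \<mu> \<longrightarrow> f s = 0)}"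

definition L2_inner :: "'a measure \<Rightarrow> ('a \<Rightarrow> real) \<Rightarrow> ('a \<Rightarrow> real) \<Rightarrow> real" where
  "L2_inner \<mu> f g = (\<integral>t. f t * g t \<partial>\<mu>)"

text \<open>Positive definite in the sense of Aronszajn: all Gram matrices are positive semidefinite.\<close>

definition symmetric_kernel_on :: "'a set \<Rightarrow> ('a \<Rightarrow> 'a \<Rightarrow> real) \<Rightarrow> bool" where
  "symmetric_kernel_on \<Omega> k \<longleftrightarrow> (\<forall>s\<in>\<Omega>. \<forall>t\<in>\<Omega>. k s t = k t s)"

definition pos_def_kernel_on :: "'a set \<Rightarrow> ('a \<Rightarrow> 'a \<Rightarrow> real) \<Rightarrow> bool" where
  "pos_def_kernel_on \<Omega> k \<longleftrightarrow>
     (\<forall>S a. finite S \<and> S \<subseteq> \<Omega> \<longrightarrow> (\<Sum>s\<in>S. \<Sum>t\<in>S. a s * a t * k s t) \<ge> 0)"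

definition integral_op :: "'a measure \<Rightarrow> ('a \<Rightarrow> 'a \<Rightarrow> real) \<Rightarrow> ('a \<Rightarrow> real) \<Rightarrow> 'a \<Rightarrow> real" where
  "integral_op \<mu> k f = (\<lambda>s. if s \<in> space \<mu> then \<integral>t. k s t * f t \<partial>\<mu> else 0)"

text \<open>The integrability clause excludes the default value of the integral of a non-integrable function.\<close>

definition is_integral_operator ::
  "'a measure \<Rightarrow> ('a \<Rightarrow> 'a \<Rightarrow> real) \<Rightarrow> (('a \<Rightarrow> real) \<Rightarrow> 'a \<Rightarrow> real) \<Rightarrow> bool" where
  "is_integral_operator \<mu> r T \<longleftrightarrow>
     (\<lambda>(s, t). r s t) \<in> borel_measurable (\<mu> \<Otimes>\<^sub>M \<mu>) \<and>
     (\<forall>f\<in>L2 \<mu>. (\<forall>s\<in>space \<mu>. integrable \<mu> (\<lambda>t. r s t * f t)) \<and> T f = integral_op \<mu> r f)"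

definition X_op :: "'a measure \<Rightarrow> ('p::finite \<Rightarrow> 'a \<Rightarrow> real) \<Rightarrow> real ^ 'p \<Rightarrow> 'a \<Rightarrow> real" where
  "X_op \<mu> x \<beta> = (\<lambda>s. if s \<in> space \<mu> then \<Sum>j\<in>UNIV. \<beta> $ j * x j s else 0)"

definition X_adj :: "'a measure \<Rightarrow> ('p::finite \<Rightarrow> 'a \<Rightarrow> real) \<Rightarrow> ('a \<Rightarrow> real) \<Rightarrow> real ^ 'p" where
  "X_adj \<mu> x h = (\<chi> j. L2_inner \<mu> h (x j))"

definition A_op ::
  "'a measure \<Rightarrow> ('a \<Rightarrow> 'a \<Rightarrow> real) \<Rightarrow> real \<Rightarrow> real \<Rightarrow> ('a \<Rightarrow> real) \<Rightarrow> 'a \<Rightarrow> real" where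
  "A_op \<mu> k c \<gamma> f = (\<lambda>s. c * integral_op \<mu> k f s + \<gamma> * f s)"

text \<open>
  \<open>L2 \<mu>\<close> consists of functions, not of classes modulo null sets. The inverse of \<open>A = cK + \<gamma>I\<close> can
  be taken at this level: \<open>K\<close> sends almost everywhere equal functions to the same function, so if
  \<open>A g = f\<close> almost everywhere then \<open>(f - cKg)/\<gamma>\<close> agrees with \<open>g\<close> almost everywhere and is the only
  function that \<open>A\<close> maps to \<open>f\<close> everywhere on \<open>\<Omega>\<close>.
\<close>

definition A_inv ::
  "'a measure \<Rightarrow> ('a \<Rightarrow> 'a \<Rightarrow> real) \<Rightarrow> real \<Rightarrow> real \<Rightarrow> ('a \<Rightarrow> real) \<Rightarrow> 'a \<Rightarrow> real" where
  "A_inv \<mu> k c \<gamma> = inv_into (L2 \<mu>) (A_op \<mu> k c \<gamma>)"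

definition XAX ::
  "'a measure \<Rightarrow> ('a \<Rightarrow> 'a \<Rightarrow> real) \<Rightarrow> ('p::finite \<Rightarrow> 'a \<Rightarrow> real) \<Rightarrow> real \<Rightarrow> real \<Rightarrow> real ^ 'p \<Rightarrow> real ^ 'p" where
  "XAX \<mu> k x c \<gamma> = (\<lambda>\<beta>. X_adj \<mu> x (A_inv \<mu> k c \<gamma> (X_op \<mu> x \<beta>)))"

definition R_inf ::
  "'a measure \<Rightarrow> ('a \<Rightarrow> 'a \<Rightarrow> real) \<Rightarrow> ('p::finite \<Rightarrow> 'a \<Rightarrow> real) \<Rightarrow> real \<Rightarrow> real \<Rightarrow> ('a \<Rightarrow> real) \<Rightarrow> 'a \<Rightarrow> real" where
  "R_inf \<mu> k x c \<gamma> f = (\<lambda>s. 1 / c * (f s - \<gamma> * (A_inv \<mu> k c \<gamma> f s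
     - A_inv \<mu> k c \<gamma> (X_op \<mu> x (inv (XAX \<mu> k x c \<gamma>) (X_adj \<mu> x (A_inv \<mu> k c \<gamma> f)))) s)))"

definition hilbert_function_space ::
  "'a set \<Rightarrow> ('a \<Rightarrow> real) set \<Rightarrow> (('a \<Rightarrow> real) \<Rightarrow> ('a \<Rightarrow> real) \<Rightarrow> real) \<Rightarrow> bool" where
  "hilbert_function_space \<Omega> H ip \<longleftrightarrow>
     (\<forall>f\<in>H. \<forall>s. s \<notin> \<Omega> \<longrightarrow> f s = 0) \<and>
     (\<lambda>s. 0) \<in> H \<and>
     (\<forall>f\<in>H. \<forall>g\<in>H. (\<lambda>s. f s + g s) \<in> H) \<and>
     (\<forall>f\<in>H. \<forall>a. (\<lambda>s. a * f s) \<in> H) \<and>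
     (\<forall>f\<in>H. \<forall>g\<in>H. ip f g = ip g f) \<and>
     (\<forall>f\<in>H. \<forall>g\<in>H. \<forall>h\<in>H. ip (\<lambda>s. f s + g s) h = ip f h + ip g h) \<and>
     (\<forall>f\<in>H. \<forall>g\<in>H. \<forall>a. ip (\<lambda>s. a * f s) g = a * ip f g) \<and>
     (\<forall>f\<in>H. ip f f \<ge> 0 \<and> (ip f f = 0 \<longrightarrow> f = (\<lambda>s. 0))) \<and>
     (let d = (\<lambda>f g. sqrt (ip (\<lambda>s. f s - g s) (\<lambda>s. f s - g s))) in
       \<forall>F. (\<forall>n::nat. F n \<in> H) \<and> (\<forall>e>0. \<exists>N. \<forall>m\<ge>N. \<forall>n\<ge>N. d (F m) (F n) < e)
         \<longrightarrow> (\<exists>f\<in>H. (\<lambda>n. d (F n) f) \<longlonglongrightarrow> 0))"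

definition is_RKHS ::
  "'a set \<Rightarrow> ('a \<Rightarrow> real) set \<Rightarrow> (('a \<Rightarrow> real) \<Rightarrow> ('a \<Rightarrow> real) \<Rightarrow> real) \<Rightarrow> ('a \<Rightarrow> 'a \<Rightarrow> real) \<Rightarrow> bool" where
  "is_RKHS \<Omega> H ip r \<longleftrightarrow>
     hilbert_function_space \<Omega> H ip \<and>
     (\<forall>t\<in>\<Omega>. let r\<^sub>t = (\<lambda>s. if s \<in> \<Omega> then r s t else 0) in
        r\<^sub>t \<in> H \<and> (\<forall>f\<in>H. f t = ip f r\<^sub>t))"

end

theory Submission
  imports Defs
begin

text \<open>
  Write \<open>q\<^sub>t = A\<^sup>-\<^sup>1 k(\<sqdot>, t)\<close> and \<open>u\<^sub>j = A\<^sup>-\<^sup>1 x\<^sub>j\<close>. Since \<open>(I - \<gamma> A\<^sup>-\<^sup>1) / c = K A\<^sup>-\<^sup>1\<close>, the operator has the kernel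
  \<open>q\<^sub>t(s) + (\<gamma> / c) u(s) \<bullet> M\<^sup>-\<^sup>1 u(t)\<close> with \<open>M = X\<^sup>* A\<^sup>-\<^sup>1 X\<close> symmetric and positive definite. The second
  summand is clearly a positive kernel. For the first one, let \<open>\<nu>\<close> be a combination of point masses and
  let \<open>g\<close> be the corresponding combination of the \<open>q\<^sub>t\<close>; positivity of \<open>k\<close> against the signed measure
  \<open>\<nu> - c g \<mu>\<close> gives \<open>\<integral> g d\<nu> \<ge> c \<parallel>g\<parallel>\<^sup>2 \<ge> 0\<close>.
  By the Moore--Aronszajn theorem, a symmetric positive kernel reproduces a Hilbert space.
\<close>

section \<open>Reproducing kernel Hilbert spaces\<close>

text \<open>A reproducing kernel must be positive on arbitrary finite sets of points, which may be
  \<mu>-null, so positivity of the operator on L2 says too little. This is why point masses and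
  densities are mixed in one quadratic form, and why positivity of \<open>k\<close> is carried from
  finite sums to integrals by Riemann sums, with an error controlled by uniform continuity on the
  compact domain. For the same reason \<open>L2\<close> is handled as a space of functions with a
  degenerate inner product: the inverse of \<open>A\<close> has to be a genuine function, defined
  everywhere. What makes this possible is that \<open>K f\<close> is bounded at every point by a
  multiple of the L1 norm of \<open>f\<close>; hence \<open>K\<close> kills null functions, and
  geometric decay in L2 becomes uniform convergence once \<open>K\<close> is applied. Definiteness
  of \<open>M\<close> rests on coercivity of \<open>A\<close>, together with the hypothesis that the
  span of the \<open>x j\<close> embeds in L2. The identity for K A^-1 is A A^-1 = I rewritten, and
  evaluating K A^-1 f at s pairs f with q_s because A^-1 is self-adjoint.\<close>

definition ev :: "(real \<times> 'a) list \<Rightarrow> ('a \<Rightarrow> real) \<Rightarrow> real" where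
  "ev a f = (\<Sum>(w, s)\<leftarrow>a. w * f s)"

definition scale :: "real \<Rightarrow> (real \<times> 'a) list \<Rightarrow> (real \<times> 'a) list" where
  "scale c = map (\<lambda>(w, s). (c * w, s))"

text \<open>The double integral of \<open>r\<close> against two finitely supported signed measures.
  Weighted points form a list, with repetitions allowed, so that adding measures is \<open>@\<close>
  and bilinearity follows by induction.\<close>

definition gram :: "('a \<Rightarrow> 'a \<Rightarrow> real) \<Rightarrow> (real \<times> 'a) list \<Rightarrow> (real \<times> 'a) list \<Rightarrow> real" where
  "gram r a b = ev a (\<lambda>s. ev b (r s))"

lemma ev_simps [simp]:
  "ev [] f = 0" "ev ((w, s) # a) f = w * f s + ev a f" "ev (a @ b) f = ev a f + ev b f"
  by (simp_all add: ev_def)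

lemma ev_scale [simp]: "ev (scale c a) f = c * ev a f"
  by (induction a) (auto simp: scale_def algebra_simps)

lemma ev_add: "ev a (\<lambda>s. f s + g s) = ev a f + ev a g"
  by (induction a) (auto simp: algebra_simps)

lemma ev_diff: "ev a (\<lambda>s. f s - g s) = ev a f - ev a g"
  by (induction a) (auto simp: algebra_simps)

lemma ev_mult: "ev a (\<lambda>s. c * f s) = c * ev a f"
  by (induction a) (auto simp: algebra_simps)

lemma ev_zero [simp]: "ev a (\<lambda>s. 0) = 0"
  by (induction a) auto

lemma ev_cong: "a \<in> lists (UNIV \<times> S) \<Longrightarrow> (\<And>s. s \<in> S \<Longrightarrow> f s = g s) \<Longrightarrow> ev a f = ev a g"
  by (induction a) auto

lemma ev_abs_le:
  "a \<in> lists (UNIV \<times> S) \<Longrightarrow> (\<And>s. s \<in> S \<Longrightarrow> \<bar>f s\<bar> \<le> e) \<Longrightarrow> \<bar>ev a f\<bar> \<le> e * (\<Sum>(w, s)\<leftarrow>a. \<bar>w\<bar>)"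
proof (induction a)
  case (Cons p a)
  obtain w s where p: "p = (w, s)" by force
  have "\<bar>w * f s\<bar> \<le> \<bar>w\<bar> * e"
    unfolding abs_mult using Cons.prems p by (intro mult_left_mono) auto
  moreover have "\<bar>ev a f\<bar> \<le> e * (\<Sum>(w, s)\<leftarrow>a. \<bar>w\<bar>)"
    using Cons by auto
  ultimately show ?case
    unfolding p by (simp add: algebra_simps)
qed simp

lemma ev_tendsto:
  "a \<in> lists (UNIV \<times> S) \<Longrightarrow> (\<And>s. s \<in> S \<Longrightarrow> (\<lambda>n. F n s) \<longlonglongrightarrow> f s) \<Longrightarrow> (\<lambda>n. ev a (F n)) \<longlonglongrightarrow> ev a f"
  by (induction a) (auto intro!: tendsto_intros)

lemma ev_swap: "ev a (\<lambda>s. ev b (\<lambda>t. g s t)) = ev b (\<lambda>t. ev a (\<lambda>s. g s t))"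
  by (induction a) (auto simp: ev_add ev_mult)

lemma scale_in_lists [simp]: "a \<in> lists (UNIV \<times> S) \<Longrightarrow> scale c a \<in> lists (UNIV \<times> S)"
  by (induction a) (auto simp: scale_def)

lemma gram_simps [simp]:
  "gram r [] b = 0" "gram r a [] = 0"
  "gram r (a @ a') b = gram r a b + gram r a' b" "gram r a (b @ b') = gram r a b + gram r a b'"
  "gram r (scale c a) b = c * gram r a b" "gram r a (scale c b) = c * gram r a b"
  by (simp_all add: gram_def ev_add ev_mult)

lemma gram_commute:
  assumes "symmetric_kernel_on \<Omega> r" "a \<in> lists (UNIV \<times> \<Omega>)" "b \<in> lists (UNIV \<times> \<Omega>)"
  shows "gram r a b = gram r b a"
proof -
  have "gram r b a = ev a (\<lambda>s. ev b (\<lambda>t. r t s))"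
    unfolding gram_def by (rule ev_swap)
  also have "\<dots> = gram r a b"
    unfolding gram_def using assms
    by (auto intro!: ev_cong[where S=\<Omega>] simp: symmetric_kernel_on_def)
  finally show ?thesis ..
qed

text \<open>Repeated points of the list are merged by adding their weights. This links lists to
  \<open>pos_def_kernel_on\<close>, which speaks of finite sets.\<close>

lemma ev_as_sum: "\<exists>w. \<forall>f. ev a f = (\<Sum>s\<in>snd ` set a. w s * f s)"
proof (induction a)
  case (Cons p a)
  obtain v s where p: "p = (v, s)" by force
  define S where "S = snd ` set a"
  have [simp]: "finite S" by (simp add: S_def)
  obtain w where w: "\<And>f. ev a f = (\<Sum>s\<in>S. w s * f s)"
    using Cons S_def by auto
  define w' where "w' = (\<lambda>t. (if t \<in> S then w t else 0) + (if t = s then v else 0))"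
  have "ev (p # a) f = (\<Sum>t\<in>insert s S. w' t * f t)" for f
  proof -
    have "(\<Sum>t\<in>insert s S. w' t * f t)
      = (\<Sum>t\<in>insert s S. if t \<in> S then w t * f t else 0) + (\<Sum>t\<in>insert s S. if t = s then v * f t else 0)"
      unfolding sum.distrib[symmetric] by (rule sum.cong) (auto simp: w'_def algebra_simps)
    also have "(\<Sum>t\<in>insert s S. if t \<in> S then w t * f t else 0) = (\<Sum>t\<in>S. w t * f t)"
      by (rule sum.mono_neutral_cong_right) auto
    also have "(\<Sum>t\<in>insert s S. if t = s then v * f t else 0) = v * f s"
      by simp
    finally show ?thesis by (simp add: p w)
  qed
  then show ?case by (auto simp: S_def p)
qed simp

lemma gram_nonneg:
  assumes "pos_def_kernel_on \<Omega> r" "a \<in> lists (UNIV \<times> \<Omega>)"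
  shows "gram r a a \<ge> 0"
proof -
  obtain w where w: "\<And>f. ev a f = (\<Sum>s\<in>snd ` set a. w s * f s)"
    using ev_as_sum by blast
  have "gram r a a = (\<Sum>s\<in>snd ` set a. \<Sum>t\<in>snd ` set a. w s * w t * r s t)"
    by (simp add: gram_def w sum_distrib_left mult.assoc)
  moreover have "snd ` set a \<subseteq> \<Omega>"
    using assms(2) by auto
  ultimately show ?thesis
    using assms(1) by (auto simp: pos_def_kernel_on_def)
qed

lemma pos_def_kernel_onI:
  assumes "\<And>a. a \<in> lists (UNIV \<times> \<Omega>) \<Longrightarrow> gram r a a \<ge> 0"
  shows "pos_def_kernel_on \<Omega> r"
  unfolding pos_def_kernel_on_def
proof (intro allI impI)
  fix S and w :: "'a \<Rightarrow> real" assume S: "finite S \<and> S \<subseteq> \<Omega>"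
  then obtain xs where xs: "set xs = S" "distinct xs"
    using finite_distinct_list by blast
  define a where "a = map (\<lambda>s. (w s, s)) xs"
  have ev: "ev a f = (\<Sum>s\<in>S. w s * f s)" for f
    using xs by (simp add: a_def ev_def o_def sum_list_distinct_conv_sum_set)
  have "gram r a a \<ge> 0"
    using S xs by (intro assms) (auto simp: a_def)
  then show "0 \<le> (\<Sum>s\<in>S. \<Sum>t\<in>S. w s * w t * r s t)"
    by (simp add: gram_def ev sum_distrib_left mult.assoc)
qed

text \<open>The functional passes through the inner product by linearity, so the Gram form collapses
  to the form of \<open>N\<close> at one vector, the \<open>a\<close>-combination of the
  \<open>v s\<close>.\<close>

lemma gram_inner_nonneg:
  fixes v :: "'a \<Rightarrow> real ^ 'n::finite" and N :: "real ^ 'n \<Rightarrow> real ^ 'n"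
  assumes sym: "\<And>y z. y \<bullet> N z = N y \<bullet> z" and nonneg: "\<And>y. 0 \<le> y \<bullet> N y"
  shows "0 \<le> gram (\<lambda>s t. v s \<bullet> N (v t)) a a"
proof -
  define y where "y = (\<chi> j. ev a (\<lambda>t. v t $ j))"
  have ev_sum: "ev a (\<lambda>t. \<Sum>j\<in>J. F j t) = (\<Sum>j\<in>J. ev a (F j))" for F and J :: "'n set"
    by (induction J rule: infinite_finite_induct) (simp_all add: ev_add)
  have ev_inner: "ev a (\<lambda>t. w \<bullet> v t) = w \<bullet> y" for w
    by (simp add: inner_vec_def ev_sum ev_mult y_def)
  have "gram (\<lambda>s t. v s \<bullet> N (v t)) a a = ev a (\<lambda>s. v s \<bullet> N y)"
    unfolding gram_def sym ev_inner ..
  also have "\<dots> = y \<bullet> N y"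
    using ev_inner[of "N y"] by (simp add: inner_commute)
  finally show ?thesis using nonneg by simp
qed

text \<open>Cauchy's functional equation. The deviation \<open>\<psi>\<close> from the linear
  function is additive and vanishes on the integers, hence has period 1 and is bounded everywhere;
  as \<psi>(n x) = n \<psi>(x), it is zero. This supplies the homogeneity of
  \<open>rkhs_inner\<close>, for which additivity comes first.\<close>

lemma additive_bounded_imp_linear:
  fixes \<phi> :: "real \<Rightarrow> real"
  assumes add: "\<And>x y. \<phi> (x + y) = \<phi> x + \<phi> y"
    and bound: "\<And>x. 0 \<le> x \<Longrightarrow> x \<le> 1 \<Longrightarrow> \<bar>\<phi> x\<bar> \<le> C"
  shows "\<phi> x = x * \<phi> 1"
proof -
  define \<psi> where "\<psi> x = \<phi> x - x * \<phi> 1" for x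
  have \<psi>_add: "\<psi> (x + y) = \<psi> x + \<psi> y" for x y
    by (simp add: \<psi>_def add algebra_simps)
  have \<psi>0: "\<psi> 0 = 0" using \<psi>_add[of 0 0] by simp
  have \<psi>_nat: "\<psi> (of_nat n * x) = of_nat n * \<psi> x" for n x
    by (induction n) (auto simp: \<psi>0 \<psi>_add algebra_simps)
  have \<psi>_minus: "\<psi> (- x) = - \<psi> x" for x
    using \<psi>_add[of x "-x"] \<psi>0 by simp
  have "\<psi> (of_nat n) = 0" for n
    using \<psi>_nat[of n 1] by (simp add: \<psi>_def)
  then have \<psi>_int: "\<psi> (of_int i) = 0" for i
    by (cases i rule: int_cases2) (auto simp: \<psi>_minus)
  have \<psi>_bound: "\<bar>\<psi> x\<bar> \<le> C + \<bar>\<phi> 1\<bar>" for x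
  proof -
    have "\<psi> x = \<psi> (frac x)"
      using \<psi>_add[of "frac x" "of_int \<lfloor>x\<rfloor>"] \<psi>_int by (simp add: frac_def)
    moreover have "\<bar>\<psi> (frac x)\<bar> \<le> \<bar>\<phi> (frac x)\<bar> + \<bar>frac x * \<phi> 1\<bar>"
      unfolding \<psi>_def by (rule abs_triangle_ineq4)
    moreover have "\<bar>\<phi> (frac x)\<bar> \<le> C"
      by (intro bound) (auto simp: frac_lt_1 less_imp_le)
    moreover have "\<bar>frac x * \<phi> 1\<bar> \<le> \<bar>\<phi> 1\<bar>"
      by (simp add: abs_mult mult_left_le_one_le frac_lt_1 less_imp_le)
    ultimately show ?thesis by linarith
  qed
  have "\<psi> x = 0"
  proof (rule ccontr)
    assume "\<psi> x \<noteq> 0"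
    then obtain n :: nat where "C + \<bar>\<phi> 1\<bar> < of_nat n * \<bar>\<psi> x\<bar>"
      using reals_Archimedean3[of "\<bar>\<psi> x\<bar>"] by auto
    then show False
      using \<psi>_bound[of "of_nat n * x"] \<psi>_nat[of n x] by (simp add: abs_mult)
  qed
  then show ?thesis by (simp add: \<psi>_def)
qed

text \<open>
  The squared norm of the Hilbert space with kernel \<open>r\<close> is the convex conjugate of the Gram form:
  \<open>\<parallel>f\<parallel>\<^sup>2 = sup\<^sub>a (2 \<Sum>\<^sub>i a\<^sub>i f(s\<^sub>i) - \<Sum>\<^sub>i\<^sub>j a\<^sub>i a\<^sub>j r(s\<^sub>i, s\<^sub>j))\<close>. Taking this as the definition
  makes the space complete by lower semicontinuity, and no abstract completion is needed.
\<close>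

locale pos_def_kernel =
  fixes \<Omega> :: "'a set" and r :: "'a \<Rightarrow> 'a \<Rightarrow> real"
  assumes sym: "symmetric_kernel_on \<Omega> r" and pos: "pos_def_kernel_on \<Omega> r"
begin

abbreviation points :: "(real \<times> 'a) list set" where
  "points \<equiv> lists (UNIV \<times> \<Omega>)"

definition conj_form :: "('a \<Rightarrow> real) \<Rightarrow> (real \<times> 'a) list \<Rightarrow> real" where
  "conj_form f a = 2 * ev a f - gram r a a"

definition sq_norm :: "('a \<Rightarrow> real) \<Rightarrow> real" where
  "sq_norm f = (SUP a\<in>points. conj_form f a)"

definition rkhs :: "('a \<Rightarrow> real) set" where
  "rkhs = {f. (\<forall>s. s \<notin> \<Omega> \<longrightarrow> f s = 0) \<and> bdd_above (conj_form f ` points)}"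

text \<open>Polarization: the supremum yields only a squared norm. Bilinearity is recovered from the
  parallelogram law, following Jordan and von Neumann.\<close>

definition rkhs_inner :: "('a \<Rightarrow> real) \<Rightarrow> ('a \<Rightarrow> real) \<Rightarrow> real" where
  "rkhs_inner f g = (sq_norm (\<lambda>s. f s + g s) - sq_norm (\<lambda>s. f s - g s)) / 4"

definition section_at :: "'a \<Rightarrow> 'a \<Rightarrow> real" where
  "section_at t = (\<lambda>s. if s \<in> \<Omega> then r s t else 0)"

lemma conj_form_le: "f \<in> rkhs \<Longrightarrow> a \<in> points \<Longrightarrow> conj_form f a \<le> sq_norm f"
  unfolding sq_norm_def rkhs_def by (intro cSUP_upper) auto

lemma sq_norm_le: "(\<And>a. a \<in> points \<Longrightarrow> conj_form f a \<le> C) \<Longrightarrow> sq_norm f \<le> C"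
  unfolding sq_norm_def by (intro cSUP_least) auto

lemma rkhsI:
  "(\<And>s. s \<notin> \<Omega> \<Longrightarrow> f s = 0) \<Longrightarrow> (\<And>a. a \<in> points \<Longrightarrow> conj_form f a \<le> C) \<Longrightarrow> f \<in> rkhs"
  unfolding rkhs_def by (auto intro!: bdd_aboveI)

lemma rkhs_outside: "f \<in> rkhs \<Longrightarrow> s \<notin> \<Omega> \<Longrightarrow> f s = 0"
  by (auto simp: rkhs_def)

lemma sq_norm_nonneg: "f \<in> rkhs \<Longrightarrow> 0 \<le> sq_norm f"
  using conj_form_le[of f "[]"] by (simp add: conj_form_def)

lemma zero_in_rkhs: "(\<lambda>s. 0) \<in> rkhs"
  by (rule rkhsI[where C = 0]) (auto simp: conj_form_def gram_nonneg[OF pos])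

lemma sq_norm_zero: "sq_norm (\<lambda>s. 0) = 0"
  by (intro antisym sq_norm_le sq_norm_nonneg zero_in_rkhs)
    (auto simp: conj_form_def gram_nonneg[OF pos])

section \<open>Homogeneity, the parallelogram law and the inner product\<close>

lemma conj_form_scale:
  assumes "c \<noteq> 0"
  shows "conj_form (\<lambda>s. c * f s) a = c\<^sup>2 * conj_form f (scale (1 / c) a)"
  using assms by (simp add: conj_form_def ev_mult field_simps power2_eq_square)

lemma
  assumes "f \<in> rkhs"
  shows scale_in_rkhs: "(\<lambda>s. c * f s) \<in> rkhs" and sq_norm_scale_le: "sq_norm (\<lambda>s. c * f s) \<le> c\<^sup>2 * sq_norm f"
proof -
  have *: "conj_form (\<lambda>s. c * f s) a \<le> c\<^sup>2 * sq_norm f" if "a \<in> points" for a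
  proof (cases "c = 0")
    case True
    then show ?thesis using that by (simp add: conj_form_def gram_nonneg[OF pos])
  next
    case False
    then show ?thesis
      using conj_form_le[OF assms, of "scale (1 / c) a"] that
      by (simp add: conj_form_scale mult_left_mono)
  qed
  show "(\<lambda>s. c * f s) \<in> rkhs"
    using assms by (intro rkhsI[OF _ *]) (auto simp: rkhs_outside)
  show "sq_norm (\<lambda>s. c * f s) \<le> c\<^sup>2 * sq_norm f"
    by (rule sq_norm_le[OF *])
qed

lemma sq_norm_scale:
  assumes "f \<in> rkhs"
  shows "sq_norm (\<lambda>s. c * f s) = c\<^sup>2 * sq_norm f"
proof (cases "c = 0")
  case True
  then show ?thesis by (simp add: sq_norm_zero)
next
  case False
  then have "sq_norm f \<le> (1 / c)\<^sup>2 * sq_norm (\<lambda>s. c * f s)"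
    using sq_norm_scale_le[OF scale_in_rkhs[OF assms, of c], of "1 / c"] by simp
  then have "c\<^sup>2 * sq_norm f \<le> c\<^sup>2 * ((1 / c)\<^sup>2 * sq_norm (\<lambda>s. c * f s))"
    by (intro mult_left_mono) auto
  also have "\<dots> = sq_norm (\<lambda>s. c * f s)"
    using False by (simp add: power_divide)
  finally have "c\<^sup>2 * sq_norm f \<le> sq_norm (\<lambda>s. c * f s)" .
  then show ?thesis using sq_norm_scale_le[OF assms, of c] by simp
qed

text \<open>The change of variables from (a, b) to ((a + b) / 2, (a - b) / 2) decouples the two
  forms; under the suprema it turns one side of the parallelogram law into the other.\<close>

lemma conj_form_parallelogram:
  assumes "a \<in> points" "b \<in> points"
  shows "conj_form (\<lambda>s. f s + g s) a + conj_form (\<lambda>s. f s - g s) b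
    = 2 * conj_form f (scale (1/2) (a @ b)) + 2 * conj_form g (scale (1/2) (a @ scale (-1) b))"
  using gram_commute[OF sym assms]
  by (simp add: conj_form_def ev_add ev_diff field_simps)

lemma
  assumes "f \<in> rkhs" "g \<in> rkhs"
  shows add_in_rkhs: "(\<lambda>s. f s + g s) \<in> rkhs"
    and diff_in_rkhs: "(\<lambda>s. f s - g s) \<in> rkhs"
    and parallelogram_le:
      "sq_norm (\<lambda>s. f s + g s) + sq_norm (\<lambda>s. f s - g s) \<le> 2 * sq_norm f + 2 * sq_norm g"
proof -
  let ?C = "2 * sq_norm f + 2 * sq_norm g"
  have *: "conj_form (\<lambda>s. f s + g s) a + conj_form (\<lambda>s. f s - g s) b \<le> ?C"
    if "a \<in> points" "b \<in> points" for a b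
    unfolding conj_form_parallelogram[OF that] using that assms
    by (intro add_mono mult_left_mono conj_form_le) auto
  \<comment> \<open>The empty list contributes 0, so the joint bound also bounds each form
    alone.\<close>
  have 1: "conj_form (\<lambda>s. f s + g s) a \<le> ?C" if "a \<in> points" for a
    using *[OF that, of "[]"] by (simp add: conj_form_def)
  have 2: "conj_form (\<lambda>s. f s - g s) b \<le> ?C" if "b \<in> points" for b
    using *[OF _ that, of "[]"] by (simp add: conj_form_def)
  show "(\<lambda>s. f s + g s) \<in> rkhs" "(\<lambda>s. f s - g s) \<in> rkhs"
    using assms by (auto intro!: rkhsI[OF _ 1] rkhsI[OF _ 2] simp: rkhs_outside)
  \<comment> \<open>\<open>a\<close> and \<open>b\<close> vary independently, so the suprema can be
    taken one after the other, here over \<open>a\<close> with \<open>b\<close> fixed.\<close>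
  have "sq_norm (\<lambda>s. f s + g s) \<le> ?C - conj_form (\<lambda>s. f s - g s) b" if "b \<in> points" for b
    using *[OF _ that] by (intro sq_norm_le) (simp add: le_diff_eq)
  then have "sq_norm (\<lambda>s. f s - g s) \<le> ?C - sq_norm (\<lambda>s. f s + g s)"
    by (intro sq_norm_le) (simp add: le_diff_eq add.commute)
  then show "sq_norm (\<lambda>s. f s + g s) + sq_norm (\<lambda>s. f s - g s) \<le> ?C"
    by simp
qed

text \<open>Applied to \<open>f + g\<close> and \<open>f - g\<close>, whose sum and difference are
  \<open>2 f\<close> and \<open>2 g\<close>, the inequality gives its own converse.\<close>

lemma parallelogram:
  assumes "f \<in> rkhs" "g \<in> rkhs"
  shows "sq_norm (\<lambda>s. f s + g s) + sq_norm (\<lambda>s. f s - g s) = 2 * sq_norm f + 2 * sq_norm g"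
proof -
  have "sq_norm (\<lambda>s. 2 * f s) + sq_norm (\<lambda>s. 2 * g s)
    \<le> 2 * sq_norm (\<lambda>s. f s + g s) + 2 * sq_norm (\<lambda>s. f s - g s)"
    using parallelogram_le[OF add_in_rkhs[OF assms] diff_in_rkhs[OF assms]] by simp
  then show ?thesis
    using parallelogram_le[OF assms] assms by (simp add: sq_norm_scale)
qed

lemma sq_norm_minus_commute:
  assumes "f \<in> rkhs" "g \<in> rkhs"
  shows "sq_norm (\<lambda>s. f s - g s) = sq_norm (\<lambda>s. g s - f s)"
  using sq_norm_scale[OF diff_in_rkhs[OF assms(2,1)], of "-1"] by simp

lemma rkhs_inner_commute:
  "f \<in> rkhs \<Longrightarrow> g \<in> rkhs \<Longrightarrow> rkhs_inner f g = rkhs_inner g f"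
  by (simp add: rkhs_inner_def add.commute sq_norm_minus_commute[of f g])

lemma rkhs_inner_self: "f \<in> rkhs \<Longrightarrow> rkhs_inner f f = sq_norm f"
  using sq_norm_scale[of f 2] by (simp add: rkhs_inner_def sq_norm_zero)

lemma rkhs_inner_zero: "g \<in> rkhs \<Longrightarrow> rkhs_inner (\<lambda>s. 0) g = 0"
  using sq_norm_scale[of g "-1"] by (simp add: rkhs_inner_def)

text \<open>Parallelogram law for the pairs \<open>f + h\<close>, \<open>g\<close> and
  \<open>f - h\<close>, \<open>g\<close>; on subtraction the squared norms of \<open>g\<close>
  cancel.\<close>

lemma rkhs_inner_add_diff:
  assumes "f \<in> rkhs" "g \<in> rkhs" "h \<in> rkhs"
  shows "rkhs_inner (\<lambda>s. f s + g s) h + rkhs_inner (\<lambda>s. f s - g s) h = 2 * rkhs_inner f h"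
proof -
  have avg: "(a - b) / 4 + (a' - b') / 4 = 2 * ((x - y) / 4)"
    if "a + a' = 2 * x + 2 * z" "b + b' = 2 * y + 2 * z" for a b a' b' x y z :: real
    using that by (simp add: field_simps)
  have "sq_norm (\<lambda>s. f s + g s + h s) + sq_norm (\<lambda>s. f s - g s + h s)
      = 2 * sq_norm (\<lambda>s. f s + h s) + 2 * sq_norm g"
    using parallelogram[OF add_in_rkhs[OF assms(1,3)] assms(2)] by (simp add: algebra_simps)
  moreover have "sq_norm (\<lambda>s. f s + g s - h s) + sq_norm (\<lambda>s. f s - g s - h s)
      = 2 * sq_norm (\<lambda>s. f s - h s) + 2 * sq_norm g"
    using parallelogram[OF diff_in_rkhs[OF assms(1,3)] assms(2)] by (simp add: algebra_simps)
  ultimately show ?thesis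
    unfolding rkhs_inner_def by (rule avg)
qed

lemma rkhs_inner_add:
  assumes "f \<in> rkhs" "g \<in> rkhs" "h \<in> rkhs"
  shows "rkhs_inner (\<lambda>s. f s + g s) h = rkhs_inner f h + rkhs_inner g h"
proof -
  \<comment> \<open>\<open>f\<close> and \<open>g\<close> are the sum and the difference of these
    two; the same identity with \<open>?u\<close> in both places removes the factor 2.\<close>
  let ?u = "\<lambda>s. 1/2 * (f s + g s)" and ?v = "\<lambda>s. 1/2 * (f s - g s)"
  have uv: "?u \<in> rkhs" "?v \<in> rkhs"
    by (intro scale_in_rkhs add_in_rkhs diff_in_rkhs assms)+
  have 2: "(\<lambda>s. ?u s + ?u s) = (\<lambda>s. f s + g s)"
    by simp
  have "rkhs_inner f h + rkhs_inner g h = 2 * rkhs_inner ?u h"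
    using rkhs_inner_add_diff[OF uv assms(3)] by (simp add: field_simps)
  also have "\<dots> = rkhs_inner (\<lambda>s. f s + g s) h"
    using rkhs_inner_add_diff[OF uv(1) uv(1) assms(3)] unfolding 2
    by (simp add: rkhs_inner_zero assms(3))
  finally show ?thesis ..
qed

lemma rkhs_inner_scale:
  assumes f: "f \<in> rkhs" and g: "g \<in> rkhs"
  shows "rkhs_inner (\<lambda>s. c * f s) g = c * rkhs_inner f g"
proof -
  have "rkhs_inner (\<lambda>s. c * f s) g = c * rkhs_inner (\<lambda>s. 1 * f s) g"
  proof (rule additive_bounded_imp_linear)
    fix x y :: real
    show "rkhs_inner (\<lambda>s. (x + y) * f s) g = rkhs_inner (\<lambda>s. x * f s) g + rkhs_inner (\<lambda>s. y * f s) g"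
      using rkhs_inner_add[OF scale_in_rkhs[OF f, of x] scale_in_rkhs[OF f, of y] g]
      by (simp add: algebra_simps)
  next
    fix x :: real assume x: "0 \<le> x" "x \<le> 1"
    have xf: "(\<lambda>s. x * f s) \<in> rkhs"
      by (rule scale_in_rkhs[OF f])
    \<comment> \<open>The two squared norms in the polarization are nonnegative and their sum is
      known from the parallelogram law, which controls their difference.\<close>
    have "\<bar>rkhs_inner (\<lambda>s. x * f s) g\<bar> \<le> sq_norm (\<lambda>s. x * f s) + sq_norm g"
      using parallelogram[OF xf g] sq_norm_nonneg[OF add_in_rkhs[OF xf g]]
        sq_norm_nonneg[OF diff_in_rkhs[OF xf g]] sq_norm_nonneg[OF xf] sq_norm_nonneg[OF g]
      by (simp add: rkhs_inner_def abs_le_iff field_simps)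
    also have "\<dots> \<le> sq_norm f + sq_norm g"
      using x sq_norm_nonneg[OF f] by (simp add: sq_norm_scale[OF f] mult_left_le_one_le power_le_one)
    finally show "\<bar>rkhs_inner (\<lambda>s. x * f s) g\<bar> \<le> sq_norm f + sq_norm g" .
  qed
  then show ?thesis by simp
qed

section \<open>Point evaluations and completeness\<close>

text \<open>Stands in for Cauchy-Schwarz against the kernel section: a single point mass of weight e
  or -e is inserted into the supremum. Applied to differences, it makes Cauchy sequences converge
  pointwise.\<close>

lemma point_bound:
  assumes f: "f \<in> rkhs" and s: "s \<in> \<Omega>" and e: "e > 0" and le: "sq_norm f \<le> e\<^sup>2"
  shows "\<bar>f s\<bar> \<le> e * (r s s + 1) / 2"
proof -
  have *: "2 * w * f s - w * (w * r s s) \<le> e\<^sup>2" for w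
    using conj_form_le[OF f, of "[(w, s)]"] s le by (simp add: conj_form_def gram_def)
  have "2 * e * f s \<le> e * (e * (r s s + 1))" "2 * e * (- f s) \<le> e * (e * (r s s + 1))"
    using *[of e] *[of "- e"] by (simp_all add: algebra_simps power2_eq_square)
  then have "e * (2 * f s) \<le> e * (e * (r s s + 1))" "e * (2 * (- f s)) \<le> e * (e * (r s s + 1))"
    by (simp_all add: algebra_simps)
  then have "2 * f s \<le> e * (r s s + 1)" "2 * (- f s) \<le> e * (r s s + 1)"
    using e by (simp_all only: mult_le_cancel_left_pos)
  then show ?thesis by (simp add: abs_le_iff)
qed

lemma kernel_diag_nonneg: "s \<in> \<Omega> \<Longrightarrow> 0 \<le> r s s"
  using gram_nonneg[OF pos, of "[(1, s)]"] by (simp add: gram_def)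

lemma sq_norm_eq_0:
  assumes "f \<in> rkhs" "sq_norm f = 0"
  shows "f = (\<lambda>s. 0)"
proof
  fix s
  show "f s = 0"
  proof (cases "s \<in> \<Omega>")
    case True
    have "\<bar>f s\<bar> \<le> 0"
    proof (rule field_le_epsilon)
      fix e :: real assume "e > 0"
      then have "\<bar>f s\<bar> \<le> (2 * e / (r s s + 1)) * (r s s + 1) / 2"
        using kernel_diag_nonneg[OF True] by (intro point_bound[OF assms(1) True]) (auto simp: assms(2))
      then show "\<bar>f s\<bar> \<le> 0 + e"
        using kernel_diag_nonneg[OF True] by simp
    qed
    then show ?thesis by simp
  qed (simp add: rkhs_outside assms)
qed

lemma rkhs_complete:
  assumes F: "\<And>n. F n \<in> rkhs"
    and cauchy: "\<And>e. e > 0 \<Longrightarrow> \<exists>N. \<forall>m\<ge>N. \<forall>n\<ge>N. sqrt (sq_norm (\<lambda>s. F m s - F n s)) < e"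
  shows "\<exists>f\<in>rkhs. (\<lambda>n. sqrt (sq_norm (\<lambda>s. F n s - f s))) \<longlonglongrightarrow> 0"
proof -
  have sq: "\<exists>N. \<forall>m\<ge>N. \<forall>n\<ge>N. sq_norm (\<lambda>s. F m s - F n s) \<le> e\<^sup>2" if e: "e > 0" for e
  proof -
    obtain N where N: "\<And>m n. m \<ge> N \<Longrightarrow> n \<ge> N \<Longrightarrow> sqrt (sq_norm (\<lambda>s. F m s - F n s)) < e"
      using cauchy[OF e] by blast
    have "sq_norm (\<lambda>s. F m s - F n s) \<le> e\<^sup>2" if "m \<ge> N" "n \<ge> N" for m n
      using N[OF that] sqrt_le_D[of _ e] by simp
    then show ?thesis by blast
  qed
  have "\<exists>l. (\<lambda>n. F n s) \<longlonglongrightarrow> l" for s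
  proof (cases "s \<in> \<Omega>")
    case True
    have "Cauchy (\<lambda>n. F n s)"
    proof (rule metric_CauchyI)
      fix e :: real assume e: "e > 0"
      define e' where "e' = e / (r s s + 1)"
      have e': "e' > 0" "e' * (r s s + 1) = e"
        using e kernel_diag_nonneg[OF True] by (auto simp: e'_def)
      obtain N where N: "\<And>m n. m \<ge> N \<Longrightarrow> n \<ge> N \<Longrightarrow> sq_norm (\<lambda>s. F m s - F n s) \<le> e'\<^sup>2"
        using sq[OF e'(1)] by blast
      have "dist (F m s) (F n s) < e" if "m \<ge> N" "n \<ge> N" for m n
        using point_bound[OF diff_in_rkhs[OF F F] True e'(1) N[OF that]] e e'(2)
        by (simp add: dist_real_def)
      then show "\<exists>N. \<forall>m\<ge>N. \<forall>n\<ge>N. dist (F m s) (F n s) < e" by blast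
    qed
    then show ?thesis by (simp add: Cauchy_convergent_iff convergent_def)
  next
    case False
    then have "F n s = 0" for n by (simp add: rkhs_outside[OF F])
    then show ?thesis by auto
  qed
  then obtain f where f: "\<And>s. (\<lambda>n. F n s) \<longlonglongrightarrow> f s" by metis
  have f_out: "f s = 0" if "s \<notin> \<Omega>" for s
    using LIMSEQ_unique[OF f[of s]] that rkhs_outside[OF F that] by simp
  \<comment> \<open>With the measure \<open>a\<close> fixed, the form is continuous under pointwise
    convergence, so a bound valid for all large \<open>m\<close> survives the limit. The supremum
    over \<open>a\<close> is taken only afterwards.\<close>
  have lsc: "conj_form (\<lambda>s. F n s - f s) a \<le> e\<^sup>2"
    if N: "\<And>m. m \<ge> N \<Longrightarrow> sq_norm (\<lambda>s. F n s - F m s) \<le> e\<^sup>2" and a: "a \<in> points" for n N e a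
  proof (rule LIMSEQ_le_const2)
    show "(\<lambda>m. conj_form (\<lambda>s. F n s - F m s) a) \<longlonglongrightarrow> conj_form (\<lambda>s. F n s - f s) a"
      unfolding conj_form_def using a by (intro tendsto_intros ev_tendsto[where S = UNIV] f) auto
    show "\<exists>M. \<forall>m\<ge>M. conj_form (\<lambda>s. F n s - F m s) a \<le> e\<^sup>2"
      using conj_form_le[OF diff_in_rkhs[OF F F] a] N by (meson order_trans)
  qed
  obtain N where "\<And>m n. m \<ge> N \<Longrightarrow> n \<ge> N \<Longrightarrow> sq_norm (\<lambda>s. F m s - F n s) \<le> 1\<^sup>2"
    using sq[of 1] by auto
  then have "(\<lambda>s. F N s - f s) \<in> rkhs"
    by (intro rkhsI[OF _ lsc[of N _ 1]]) (auto simp: f_out rkhs_outside[OF F])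
  \<comment> \<open>\<open>f\<close> is the difference of \<open>F N\<close> and
    \<open>F N - f\<close>.\<close>
  from diff_in_rkhs[OF F this, of N] have fH: "f \<in> rkhs" by simp
  moreover have "(\<lambda>n. sqrt (sq_norm (\<lambda>s. F n s - f s))) \<longlonglongrightarrow> 0"
  proof (rule LIMSEQ_I)
    fix e :: real assume e: "0 < e"
    obtain N where N: "\<And>m n. m \<ge> N \<Longrightarrow> n \<ge> N \<Longrightarrow> sq_norm (\<lambda>s. F m s - F n s) \<le> (e / 2)\<^sup>2"
      using sq[of "e / 2"] e by auto
    have "norm (sqrt (sq_norm (\<lambda>s. F n s - f s)) - 0) < e" if n: "n \<ge> N" for n
    proof -
      have "sq_norm (\<lambda>s. F n s - f s) \<le> (e / 2)\<^sup>2"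
        by (rule sq_norm_le, rule lsc[OF N[OF n]])
      then have "sqrt (sq_norm (\<lambda>s. F n s - f s)) \<le> e / 2"
        using e by (intro real_le_lsqrt) auto
      then show ?thesis
        using e sq_norm_nonneg[OF diff_in_rkhs[OF F fH]] by simp
    qed
    then show "\<exists>no. \<forall>n\<ge>no. norm (sqrt (sq_norm (\<lambda>s. F n s - f s)) - 0) < e" by blast
  qed
  ultimately show ?thesis by blast
qed

section \<open>Kernel sections and the reproducing property\<close>

text \<open>The section at t is the potential of the unit point mass there, so completing the square
  moves it into the measure as a mass -w at t.\<close>

lemma conj_form_section:
  assumes t: "t \<in> \<Omega>" and a: "a \<in> points"
  shows "conj_form (\<lambda>s. f s + w * section_at t s) a
    = conj_form f (a @ [(- w, t)]) + (2 * w * f t + w\<^sup>2 * r t t)"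
proof -
  have "ev a (section_at t) = gram r a [(1, t)]"
    unfolding gram_def using a by (auto intro!: ev_cong[where S=\<Omega>] simp: section_at_def)
  moreover have "gram r [(1, t)] a = gram r a [(1, t)]"
    using t a by (intro gram_commute[OF sym]) auto
  moreover have "[(- w, t)] = scale (- w) [(1, t)]" by (simp add: scale_def)
  moreover have "gram r [(1, t)] [(1, t)] = r t t" by (simp add: gram_def)
  ultimately show ?thesis
    by (simp add: conj_form_def ev_add ev_mult algebra_simps power2_eq_square del: ev_simps(2))
       (simp add: algebra_simps)
qed

lemma section_in_rkhs: "section_at t \<in> rkhs" if t: "t \<in> \<Omega>"
proof (rule rkhsI)
  show "section_at t s = 0" if "s \<notin> \<Omega>" for s using that by (simp add: section_at_def)
  show "conj_form (section_at t) a \<le> r t t" if a: "a \<in> points" for a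
    using conj_form_section[OF t a, of "\<lambda>s. 0" 1] gram_nonneg[OF pos, of "a @ [(- 1, t)]"] t a
    by (simp add: conj_form_def del: gram_simps)
qed

lemma sq_norm_add_section_le:
  assumes f: "f \<in> rkhs" and t: "t \<in> \<Omega>"
  shows "sq_norm (\<lambda>s. f s + w * section_at t s) \<le> sq_norm f + (2 * w * f t + w\<^sup>2 * r t t)"
proof (rule sq_norm_le)
  fix a assume a: "a \<in> points"
  show "conj_form (\<lambda>s. f s + w * section_at t s) a \<le> sq_norm f + (2 * w * f t + w\<^sup>2 * r t t)"
    unfolding conj_form_section[OF t a] using a t by (intro add_right_mono conj_form_le[OF f]) auto
qed

text \<open>Shifting measures by a point mass is invertible, so the supremum changes by exactly 2 w
  f(t) + w^2 r(t, t): the reverse inequality is the same estimate with -w, applied to the shifted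
  function. Polarization with w = 1 and w = -1 leaves f(t).\<close>

lemma reproducing:
  assumes f: "f \<in> rkhs" and t: "t \<in> \<Omega>"
  shows "rkhs_inner f (section_at t) = f t"
proof -
  have eq: "sq_norm (\<lambda>s. f s + w * section_at t s) = sq_norm f + (2 * w * f t + w\<^sup>2 * r t t)" for w
  proof (rule antisym[OF sq_norm_add_section_le[OF f t]])
    have "(\<lambda>s. f s + w * section_at t s) \<in> rkhs"
      by (intro add_in_rkhs f scale_in_rkhs section_in_rkhs t)
    from sq_norm_add_section_le[OF this t, of "- w"]
    show "sq_norm f + (2 * w * f t + w\<^sup>2 * r t t) \<le> sq_norm (\<lambda>s. f s + w * section_at t s)"
      using t by (simp add: section_at_def algebra_simps power2_eq_square)
  qed
  show ?thesis
    using eq[of 1] eq[of "-1"] by (simp add: rkhs_inner_def)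
qed

theorem is_RKHS_rkhs: "is_RKHS \<Omega> rkhs rkhs_inner r"
  unfolding is_RKHS_def hilbert_function_space_def Let_def
proof (intro conjI ballI allI impI)
  fix F :: "nat \<Rightarrow> 'a \<Rightarrow> real"
  assume *: "(\<forall>n. F n \<in> rkhs) \<and> (\<forall>e>0. \<exists>N. \<forall>m\<ge>N. \<forall>n\<ge>N.
    sqrt (rkhs_inner (\<lambda>s. F m s - F n s) (\<lambda>s. F m s - F n s)) < e)"
  then have F: "F n \<in> rkhs" for n by blast
  show "\<exists>f\<in>rkhs. (\<lambda>n. sqrt (rkhs_inner (\<lambda>s. F n s - f s) (\<lambda>s. F n s - f s))) \<longlonglongrightarrow> 0"
    using rkhs_complete[OF F] * by (simp add: F rkhs_inner_self diff_in_rkhs cong: bex_cong)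
qed (auto simp: rkhs_outside zero_in_rkhs add_in_rkhs scale_in_rkhs
    rkhs_inner_add rkhs_inner_scale rkhs_inner_self sq_norm_nonneg sq_norm_eq_0 reproducing
    section_in_rkhs simp flip: section_at_def intro: rkhs_inner_commute)

end

section \<open>The integral operator on L2\<close>

lemma L2_integrable_mult:
  assumes "f \<in> L2 M" "g \<in> L2 M"
  shows "integrable M (\<lambda>t. f t * g t)"
proof (rule Bochner_Integration.integrable_bound)
  show "integrable M (\<lambda>t. (f t)\<^sup>2 + (g t)\<^sup>2)"
    using assms by (auto simp: L2_def)
  show "(\<lambda>t. f t * g t) \<in> borel_measurable M"
    using assms by (auto simp: L2_def)
  have "\<bar>x * y\<bar> \<le> x\<^sup>2 + y\<^sup>2" for x y :: real
  proof -
    have "0 \<le> (\<bar>x\<bar> - \<bar>y\<bar>)\<^sup>2" by simp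
    then have "2 * (\<bar>x\<bar> * \<bar>y\<bar>) \<le> x\<^sup>2 + y\<^sup>2" by (simp add: power2_diff)
    moreover have "0 \<le> \<bar>x\<bar> * \<bar>y\<bar>" by simp
    ultimately show ?thesis unfolding abs_mult by linarith
  qed
  then show "AE t in M. norm (f t * g t) \<le> norm ((f t)\<^sup>2 + (g t)\<^sup>2)"
    by (simp add: order_trans[OF _ abs_ge_self])
qed

lemma L2_scale: "f \<in> L2 M \<Longrightarrow> (\<lambda>t. a * f t) \<in> L2 M"
  by (auto simp: L2_def power_mult_distrib)

lemma L2_add:
  assumes "f \<in> L2 M" "g \<in> L2 M"
  shows "(\<lambda>t. f t + g t) \<in> L2 M"
proof -
  have "integrable M (\<lambda>t. (f t)\<^sup>2 + (g t)\<^sup>2 + 2 * (f t * g t))"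
    using L2_integrable_mult[OF assms] assms
    by (intro Bochner_Integration.integrable_add integrable_mult_right) (auto simp: L2_def)
  then show ?thesis
    using assms by (auto simp: L2_def power2_sum mult.assoc)
qed

lemma L2_diff:
  assumes "f \<in> L2 M" "g \<in> L2 M"
  shows "(\<lambda>t. f t - g t) \<in> L2 M"
  using L2_add[OF assms(1) L2_scale[OF assms(2), of "-1"]] by simp

lemma L2_zero: "(\<lambda>t. 0) \<in> L2 M"
  by (auto simp: L2_def)

lemma L2_sum: "(\<And>i. i \<in> I \<Longrightarrow> f i \<in> L2 M) \<Longrightarrow> (\<lambda>t. \<Sum>i\<in>I. f i t) \<in> L2 M"
  by (induction I rule: infinite_finite_induct) (auto intro: L2_zero L2_add)

lemma L2_measurable: "f \<in> L2 M \<Longrightarrow> f \<in> borel_measurable M"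
  by (auto simp: L2_def)

lemma L2_outside: "f \<in> L2 M \<Longrightarrow> s \<notin> space M \<Longrightarrow> f s = 0"
  by (auto simp: L2_def)

lemma L2_inner_commute: "L2_inner M f g = L2_inner M g f"
  by (simp add: L2_inner_def mult.commute)

lemma L2_inner_add:
  assumes "f \<in> L2 M" "g \<in> L2 M" "h \<in> L2 M"
  shows "L2_inner M (\<lambda>t. f t + g t) h = L2_inner M f h + L2_inner M g h"
  using assms by (simp add: L2_inner_def distrib_right L2_integrable_mult)

lemma L2_inner_scale: "L2_inner M (\<lambda>t. a * f t) h = a * L2_inner M f h"
  by (simp add: L2_inner_def mult.assoc)

lemma L2_inner_add_right:
  assumes "f \<in> L2 M" "g \<in> L2 M" "h \<in> L2 M"
  shows "L2_inner M h (\<lambda>t. f t + g t) = L2_inner M h f + L2_inner M h g"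
  using L2_inner_add[OF assms] by (simp add: L2_inner_commute)

lemma L2_inner_scale_right: "L2_inner M h (\<lambda>t. a * f t) = a * L2_inner M h f"
  using L2_inner_scale[of M a f h] by (simp add: L2_inner_commute)

lemma L2_inner_sum_right:
  assumes "\<And>i. i \<in> I \<Longrightarrow> f i \<in> L2 M" "h \<in> L2 M"
  shows "L2_inner M h (\<lambda>t. \<Sum>i\<in>I. f i t) = (\<Sum>i\<in>I. L2_inner M h (f i))"
  using assms by (simp add: L2_inner_def sum_distrib_left L2_integrable_mult)

lemma L2_inner_self_nonneg: "0 \<le> L2_inner M f f"
  by (simp add: L2_inner_def)

lemma L2_inner_add_self:
  assumes "f \<in> L2 M" "g \<in> L2 M"
  shows "L2_inner M (\<lambda>t. f t + a * g t) (\<lambda>t. f t + a * g t)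
    = L2_inner M f f + 2 * a * L2_inner M f g + a\<^sup>2 * L2_inner M g g"
  using assms
  by (simp add: L2_inner_add L2_inner_add_right L2_inner_scale L2_inner_scale_right
      L2_add L2_scale L2_inner_commute[of M g f] algebra_simps power2_eq_square)

text \<open>Expansion of the nonnegative square of f - a g, divided by a.\<close>

lemma L2_inner_le:
  assumes "f \<in> L2 M" "g \<in> L2 M" "a > 0"
  shows "2 * L2_inner M f g \<le> L2_inner M f f / a + a * L2_inner M g g"
proof -
  have "0 \<le> (L2_inner M f f + 2 * (- a) * L2_inner M f g + (- a)\<^sup>2 * L2_inner M g g) / a"
    unfolding L2_inner_add_self[OF assms(1,2), symmetric]
    using assms(3) by (intro divide_nonneg_pos L2_inner_self_nonneg)
  then show ?thesis
    using assms(3) by (simp add: field_simps power2_eq_square)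
qed

section \<open>Bounds and regularity of the kernel operator\<close>

locale kernel_operator = finite_measure \<mu>
  for \<mu> :: "'a::{metric_space, second_countable_topology} measure" +
  fixes \<Omega> :: "'a set" and k :: "'a \<Rightarrow> 'a \<Rightarrow> real"
  assumes compact: "compact \<Omega>"
    and sets_mu: "sets \<mu> = sets (restrict_space borel \<Omega>)"
    and cont_k: "continuous_on (\<Omega> \<times> \<Omega>) (\<lambda>(s, t). k s t)"
    and sym_k: "symmetric_kernel_on \<Omega> k"
    and pos_k: "pos_def_kernel_on \<Omega> k"
begin

abbreviation inner_mu (infixl "\<bullet>\<^sub>\<mu>" 70) where "f \<bullet>\<^sub>\<mu> g \<equiv> L2_inner \<mu> f g"

abbreviation K where "K \<equiv> integral_op \<mu> k"

abbreviation l1 where "l1 f \<equiv> \<integral>t. \<bar>f t\<bar> \<partial>\<mu>"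

text \<open>The added 1 makes the constant usable as a divisor even when \<mu> is zero.\<close>

definition mass :: real where "mass = measure \<mu> \<Omega> + 1"

lemma mass_pos: "mass > 0"
  by (simp add: mass_def add_nonneg_pos)

lemma space_mu: "space \<mu> = \<Omega>"
  using sets_eq_imp_space_eq[OF sets_mu] by (simp add: space_restrict_space)

lemma integral_const_le: "0 \<le> C \<Longrightarrow> (\<integral>t. C \<partial>\<mu>) \<le> mass * C"
  by (simp add: mass_def space_mu algebra_simps)

lemma continuous_on_measurable: "continuous_on \<Omega> f \<Longrightarrow> f \<in> borel_measurable \<mu>"
  for f :: "'a \<Rightarrow> real"
  using borel_measurable_continuous_on_restrict[of \<Omega> f] measurable_cong_sets[OF sets_mu refl] by blast

text \<open>By second countability the product of the Borel sigma-algebras is the Borel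
  sigma-algebra of the product, so joint continuity suffices.\<close>

lemma continuous_on_measurable_pair:
  fixes F :: "'a \<times> 'a \<Rightarrow> real"
  assumes "continuous_on (\<Omega> \<times> \<Omega>) F"
  shows "F \<in> borel_measurable (\<mu> \<Otimes>\<^sub>M \<mu>)"
proof -
  have id: "(\<lambda>s. s) \<in> \<mu> \<rightarrow>\<^sub>M borel"
    unfolding measurable_cong_sets[OF sets_mu refl] by (rule measurable_restrict_space1) simp
  have "(\<lambda>p. (fst p, snd p)) \<in> \<mu> \<Otimes>\<^sub>M \<mu> \<rightarrow>\<^sub>M borel \<Otimes>\<^sub>M borel"
    by (intro measurable_Pair measurable_compose[OF measurable_fst id] measurable_compose[OF measurable_snd id])
  then have "(\<lambda>p. p) \<in> \<mu> \<Otimes>\<^sub>M \<mu> \<rightarrow>\<^sub>M restrict_space borel (\<Omega> \<times> \<Omega>)"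
    by (intro measurable_restrict_space2) (auto simp: borel_prod space_pair_measure space_mu)
  from measurable_compose[OF this borel_measurable_continuous_on_restrict[OF assms]] show ?thesis .
qed

lemma k_measurable_pair: "(\<lambda>(s, t). k s t) \<in> borel_measurable (\<mu> \<Otimes>\<^sub>M \<mu>)"
  by (rule continuous_on_measurable_pair[OF cont_k])

lemma k_measurable: "s \<in> \<Omega> \<Longrightarrow> k s \<in> borel_measurable \<mu>"
  using measurable_Pair2[OF k_measurable_pair, of s] by (simp add: space_mu)

lemma k_commute: "s \<in> \<Omega> \<Longrightarrow> t \<in> \<Omega> \<Longrightarrow> k s t = k t s"
  using sym_k by (auto simp: symmetric_kernel_on_def)

lemma ex_k_bound: "\<exists>B>0. \<forall>s\<in>\<Omega>. \<forall>t\<in>\<Omega>. \<bar>k s t\<bar> \<le> B"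
proof -
  have "bounded ((\<lambda>(s, t). k s t) ` (\<Omega> \<times> \<Omega>))"
    by (intro compact_imp_bounded compact_continuous_image cont_k compact_Times compact)
  then obtain B where "B > 0" "\<And>p. p \<in> \<Omega> \<times> \<Omega> \<Longrightarrow> norm ((\<lambda>(s, t). k s t) p) \<le> B"
    by (auto simp: bounded_pos)
  then show ?thesis by force
qed

definition k_bound :: real where "k_bound = (SOME B. B > 0 \<and> (\<forall>s\<in>\<Omega>. \<forall>t\<in>\<Omega>. \<bar>k s t\<bar> \<le> B))"

lemma k_bound_pos: "k_bound > 0" and k_bound: "s \<in> \<Omega> \<Longrightarrow> t \<in> \<Omega> \<Longrightarrow> \<bar>k s t\<bar> \<le> k_bound"
  using someI_ex[OF ex_k_bound] by (auto simp: k_bound_def)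

lemma k_modulus:
  assumes "e > 0"
  shows "\<exists>d>0. \<forall>s\<in>\<Omega>. \<forall>s'\<in>\<Omega>. \<forall>t\<in>\<Omega>. dist s s' < d \<longrightarrow> \<bar>k s t - k s' t\<bar> \<le> e"
proof -
  have "uniformly_continuous_on (\<Omega> \<times> \<Omega>) (\<lambda>(s, t). k s t)"
    by (intro compact_uniformly_continuous cont_k compact_Times compact)
  then obtain d where d: "d > 0" "\<And>p q. p \<in> \<Omega> \<times> \<Omega> \<Longrightarrow> q \<in> \<Omega> \<times> \<Omega> \<Longrightarrow> dist q p < d
      \<Longrightarrow> dist ((\<lambda>(s, t). k s t) q) ((\<lambda>(s, t). k s t) p) < e"
    using assms unfolding uniformly_continuous_on_def by blast
  have "\<bar>k s t - k s' t\<bar> \<le> e" if "s \<in> \<Omega>" "s' \<in> \<Omega>" "t \<in> \<Omega>" "dist s s' < d" for s s' t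
    using d(2)[of "(s', t)" "(s, t)"] that by (auto simp: dist_Pair_Pair dist_real_def)
  with d(1) show ?thesis by blast
qed

lemma L2_bounded:
  assumes "f \<in> borel_measurable \<mu>" "\<And>s. s \<in> \<Omega> \<Longrightarrow> \<bar>f s\<bar> \<le> B" "\<And>s. s \<notin> \<Omega> \<Longrightarrow> f s = 0"
  shows "f \<in> L2 \<mu>"
proof -
  have "integrable \<mu> (\<lambda>t. (f t)\<^sup>2)"
  proof (rule integrable_const_bound[where B = "B\<^sup>2"])
    have "norm ((f s)\<^sup>2) \<le> B\<^sup>2" if "s \<in> \<Omega>" for s
      using power_mono[OF assms(2)[OF that], of 2] by simp
    then show "AE s in \<mu>. norm ((f s)\<^sup>2) \<le> B\<^sup>2"
      by (auto simp: space_mu)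
  qed (use assms(1) in simp)
  then show ?thesis
    using assms by (auto simp: L2_def space_mu)
qed

lemma L2_integrable:
  assumes "f \<in> L2 \<mu>"
  shows "integrable \<mu> f"
proof -
  have "(\<lambda>t. if t \<in> \<Omega> then 1 else 0) \<in> L2 \<mu>"
    using measurable_If_set[of "\<lambda>_. 1 :: real" \<mu> borel "\<lambda>_. 0" \<Omega>] space_mu sets.top[of \<mu>]
    by (intro L2_bounded[where B = 1]) auto
  from L2_integrable_mult[OF assms this] show ?thesis
    by (rule back_subst[where P = "integrable \<mu>"]) (use assms in \<open>auto simp: L2_def space_mu\<close>)
qed

text \<open>Cauchy-Schwarz against the constant 1, read off from the nonnegative square of |f| - a,
  where \<open>a\<close> is the mean of |f| up to \<open>mass\<close> replacing the measure of the
  domain.\<close>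

lemma l1_sq_le:
  assumes f: "f \<in> L2 \<mu>"
  shows "(l1 f)\<^sup>2 \<le> mass * (f \<bullet>\<^sub>\<mu> f)"
proof -
  define a where "a = l1 f / mass"
  have i: "integrable \<mu> f" "integrable \<mu> (\<lambda>t. f t * f t)"
    using L2_integrable[OF f] L2_integrable_mult[OF f f] by auto
  have "0 \<le> (\<integral>t. (\<bar>f t\<bar> - a)\<^sup>2 \<partial>\<mu>)" by simp
  also have "\<dots> = (\<integral>t. f t * f t - 2 * a * \<bar>f t\<bar> + a\<^sup>2 \<partial>\<mu>)"
    by (rule Bochner_Integration.integral_cong) (auto simp: power2_eq_square algebra_simps)
  also have "\<dots> = f \<bullet>\<^sub>\<mu> f - 2 * a * l1 f + a\<^sup>2 * measure \<mu> \<Omega>"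
    using i by (simp add: L2_inner_def space_mu)
  also have "\<dots> \<le> f \<bullet>\<^sub>\<mu> f - 2 * a * l1 f + a\<^sup>2 * mass"
    by (simp add: mass_def mult_left_mono)
  also have "\<dots> = f \<bullet>\<^sub>\<mu> f - (l1 f)\<^sup>2 / mass"
    using mass_pos by (simp add: a_def field_simps power2_eq_square)
  finally show ?thesis
    using mass_pos by (simp add: field_simps)
qed

lemma k_mult_integrable:
  assumes "s \<in> \<Omega>" "integrable \<mu> f"
  shows "integrable \<mu> (\<lambda>t. k s t * f t)"
proof (rule Bochner_Integration.integrable_bound)
  show "integrable \<mu> (\<lambda>t. k_bound * \<bar>f t\<bar>)"
    using assms(2) by simp
  show "(\<lambda>t. k s t * f t) \<in> borel_measurable \<mu>"
    using k_measurable[OF assms(1)] assms(2) by auto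
  show "AE t in \<mu>. norm (k s t * f t) \<le> norm (k_bound * \<bar>f t\<bar>)"
    using k_bound[OF assms(1)] k_bound_pos by (auto simp: space_mu abs_mult intro!: mult_right_mono)
qed

lemma K_eq: "s \<in> \<Omega> \<Longrightarrow> K f s = (\<integral>t. k s t * f t \<partial>\<mu>)"
  by (simp add: integral_op_def space_mu)

lemma K_outside: "s \<notin> \<Omega> \<Longrightarrow> K f s = 0"
  by (simp add: integral_op_def space_mu)

lemma K_bound:
  assumes f: "integrable \<mu> f"
  shows "\<bar>K f s\<bar> \<le> k_bound * l1 f"
proof (cases "s \<in> \<Omega>")
  case True
  have "\<bar>\<integral>t. k s t * f t \<partial>\<mu>\<bar> \<le> (\<integral>t. \<bar>k s t * f t\<bar> \<partial>\<mu>)"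
    by (rule integral_abs_bound)
  also have "\<dots> \<le> (\<integral>t. k_bound * \<bar>f t\<bar> \<partial>\<mu>)"
  proof (rule integral_mono)
    show "integrable \<mu> (\<lambda>t. \<bar>k s t * f t\<bar>)" "integrable \<mu> (\<lambda>t. k_bound * \<bar>f t\<bar>)"
      using k_mult_integrable[OF True f] f by auto
    show "\<bar>k s t * f t\<bar> \<le> k_bound * \<bar>f t\<bar>" if "t \<in> space \<mu>" for t
      using k_bound[OF True, of t] that by (simp add: space_mu abs_mult mult_right_mono)
  qed
  finally show ?thesis
    by (simp add: K_eq True)
qed (use k_bound_pos in \<open>simp add: K_outside\<close>)

lemma K_modulus:
  assumes f: "integrable \<mu> f" and s: "s \<in> \<Omega>" "s' \<in> \<Omega>"
    and e: "\<And>t. t \<in> \<Omega> \<Longrightarrow> \<bar>k s t - k s' t\<bar> \<le> e"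
  shows "\<bar>K f s - K f s'\<bar> \<le> e * l1 f"
proof -
  note i = k_mult_integrable[OF s(1) f] k_mult_integrable[OF s(2) f]
  have "K f s - K f s' = (\<integral>t. k s t * f t - k s' t * f t \<partial>\<mu>)"
    using i by (simp add: K_eq s)
  also have "\<bar>\<dots>\<bar> \<le> (\<integral>t. \<bar>k s t * f t - k s' t * f t\<bar> \<partial>\<mu>)"
    by (rule integral_abs_bound)
  also have "\<dots> \<le> (\<integral>t. e * \<bar>f t\<bar> \<partial>\<mu>)"
  proof (rule integral_mono)
    show "integrable \<mu> (\<lambda>t. \<bar>k s t * f t - k s' t * f t\<bar>)" "integrable \<mu> (\<lambda>t. e * \<bar>f t\<bar>)"
      using i f by auto
    show "\<bar>k s t * f t - k s' t * f t\<bar> \<le> e * \<bar>f t\<bar>" if "t \<in> space \<mu>" for t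
      using e[of t] that by (simp add: space_mu abs_mult mult_right_mono flip: left_diff_distrib)
  qed
  finally show ?thesis by simp
qed

lemma K_measurable:
  assumes f: "f \<in> borel_measurable \<mu>"
  shows "K f \<in> borel_measurable \<mu>"
proof -
  have "(\<lambda>s. \<integral>t. k s t * f t \<partial>\<mu>) \<in> borel_measurable \<mu>"
    using k_measurable_pair f by (intro borel_measurable_lebesgue_integral) (simp add: split_beta')
  then show ?thesis
    by (rule measurable_cong[THEN iffD1, rotated]) (simp add: integral_op_def)
qed

lemma K_L2: "f \<in> L2 \<mu> \<Longrightarrow> K f \<in> L2 \<mu>"
  by (rule L2_bounded[OF K_measurable K_bound]) (auto simp: K_outside L2_measurable L2_integrable)

lemma K_add:
  assumes "f \<in> L2 \<mu>" "g \<in> L2 \<mu>"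
  shows "K (\<lambda>t. f t + g t) s = K f s + K g s"
  using k_mult_integrable L2_integrable assms
  by (cases "s \<in> \<Omega>") (auto simp: K_eq K_outside distrib_left)

lemma K_scale: "K (\<lambda>t. a * f t) s = a * K f s"
  by (cases "s \<in> \<Omega>") (auto simp: K_eq K_outside mult.left_commute)

lemma K_self_adjoint:
  assumes f: "f \<in> L2 \<mu>" and g: "g \<in> L2 \<mu>"
  shows "K f \<bullet>\<^sub>\<mu> g = f \<bullet>\<^sub>\<mu> K g"
proof -
  interpret pair_sigma_finite \<mu> \<mu> ..
  let ?F = "\<lambda>s t. k s t * f t * g s"
  have fi: "integrable \<mu> f" and gi: "integrable \<mu> g" using f g L2_integrable by auto
  have [measurable]: "(\<lambda>(s, t). k s t) \<in> borel_measurable (\<mu> \<Otimes>\<^sub>M \<mu>)" "f \<in> borel_measurable \<mu>" "g \<in> borel_measurable \<mu>"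
    using k_measurable_pair fi gi by auto
  have m: "(\<lambda>(s, t). ?F s t) \<in> borel_measurable (\<mu> \<Otimes>\<^sub>M \<mu>)"
    using \<open>(\<lambda>(s, t). k s t) \<in> borel_measurable (\<mu> \<Otimes>\<^sub>M \<mu>)\<close> by (simp add: split_beta')
  have int: "integrable (\<mu> \<Otimes>\<^sub>M \<mu>) (\<lambda>(s, t). ?F s t)"
  proof (rule Bochner_Integration.integrable_bound[OF _ m])
    show "integrable (\<mu> \<Otimes>\<^sub>M \<mu>) (\<lambda>(s, t). k_bound * \<bar>g s\<bar> * \<bar>f t\<bar>)"
      by (rule Fubini_integrable) (use fi gi in \<open>auto simp: abs_mult\<close>)
    show "AE p in \<mu> \<Otimes>\<^sub>M \<mu>. norm ((\<lambda>(s, t). ?F s t) p) \<le> norm ((\<lambda>(s, t). k_bound * \<bar>g s\<bar> * \<bar>f t\<bar>) p)"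
    proof (rule AE_I2, clarify)
      fix s t assume "(s, t) \<in> space (\<mu> \<Otimes>\<^sub>M \<mu>)"
      then have "\<bar>k s t\<bar> * (\<bar>g s\<bar> * \<bar>f t\<bar>) \<le> k_bound * (\<bar>g s\<bar> * \<bar>f t\<bar>)"
        by (intro mult_right_mono k_bound) (auto simp: space_pair_measure space_mu)
      then show "norm (?F s t) \<le> norm (k_bound * \<bar>g s\<bar> * \<bar>f t\<bar>)"
        using k_bound_pos by (simp add: abs_mult mult.assoc mult.commute[of "\<bar>f t\<bar>"])
    qed
  qed
  have "K f \<bullet>\<^sub>\<mu> g = (\<integral>s. (\<integral>t. ?F s t \<partial>\<mu>) \<partial>\<mu>)"
    unfolding L2_inner_def by (rule Bochner_Integration.integral_cong) (auto simp: K_eq space_mu)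
  also have "\<dots> = (\<integral>t. (\<integral>s. ?F s t \<partial>\<mu>) \<partial>\<mu>)"
    by (rule Fubini_integral[OF int, symmetric])
  also have "\<dots> = f \<bullet>\<^sub>\<mu> K g"
    unfolding L2_inner_def
  proof (rule Bochner_Integration.integral_cong)
    fix t assume t: "t \<in> space \<mu>"
    have "(\<integral>s. ?F s t \<partial>\<mu>) = (\<integral>s. f t * (k t s * g s) \<partial>\<mu>)"
      using t by (intro Bochner_Integration.integral_cong) (auto simp: space_mu k_commute)
    also have "\<dots> = f t * K g t"
      using t by (simp add: K_eq space_mu)
    finally show "(\<integral>s. ?F s t \<partial>\<mu>) = f t * K g t" .
  qed simp
  finally show ?thesis .
qed

section \<open>Positivity: from point masses to densities\<close>

text \<open>The density \<open>f\<close> is discretized with weights equal to its integrals over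
  small cells. The list \<open>b\<close> is chosen before the test function \<open>h\<close>, since
  one discretization has to serve \<open>K f\<close> and all rows \<open>k s\<close> at
  once.\<close>

lemma riemann_sum:
  assumes f: "integrable \<mu> f" and d: "d > 0"
  shows "\<exists>b. b \<in> lists (UNIV \<times> \<Omega>) \<and> (\<Sum>(w, s)\<leftarrow>b. \<bar>w\<bar>) \<le> l1 f \<and>
    (\<forall>h e. integrable \<mu> (\<lambda>t. h t * f t) \<longrightarrow>
       (\<forall>s\<in>\<Omega>. \<forall>t\<in>\<Omega>. dist s t < d \<longrightarrow> \<bar>h s - h t\<bar> \<le> e) \<longrightarrow>
       \<bar>(\<integral>t. h t * f t \<partial>\<mu>) - ev b h\<bar> \<le> e * l1 f)"
proof -
  \<comment> \<open>The part of the domain covered by the balls listed so far; the induction cuts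
    the cells out of it greedily.\<close>
  define E where "E ps = \<Omega> \<inter> (\<Union>p\<in>set ps. ball p d)" for ps
  have meas: "\<Omega> \<inter> U \<in> sets \<mu>" if "open U" for U
    using that by (auto simp: sets_mu sets_restrict_space)
  have E_sets: "E ps \<in> sets \<mu>" for ps
    unfolding E_def by (rule meas) auto
  have *: "\<exists>b. b \<in> lists (UNIV \<times> \<Omega>) \<and> (\<Sum>(w, s)\<leftarrow>b. \<bar>w\<bar>) \<le> (\<integral>t. indicator (E ps) t * \<bar>f t\<bar> \<partial>\<mu>) \<and>
    (\<forall>h e. integrable \<mu> (\<lambda>t. h t * f t) \<longrightarrow>
       (\<forall>s\<in>\<Omega>. \<forall>t\<in>\<Omega>. dist s t < d \<longrightarrow> \<bar>h s - h t\<bar> \<le> e) \<longrightarrow>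
       \<bar>(\<integral>t. indicator (E ps) t * (h t * f t) \<partial>\<mu>) - ev b h\<bar> \<le> e * (\<integral>t. indicator (E ps) t * \<bar>f t\<bar> \<partial>\<mu>))"
    if "set ps \<subseteq> \<Omega>" for ps
    using that
  proof (induction ps)
    case Nil
    show ?case by (intro exI[of _ "[]"]) (simp add: E_def)
  next
    case (Cons p ps)
    then have "set ps \<subseteq> \<Omega>" by simp
    from Cons.IH[OF this] obtain b where b: "b \<in> lists (UNIV \<times> \<Omega>)"
      "(\<Sum>(w, s)\<leftarrow>b. \<bar>w\<bar>) \<le> (\<integral>t. indicator (E ps) t * \<bar>f t\<bar> \<partial>\<mu>)"
      "\<forall>h e. integrable \<mu> (\<lambda>t. h t * f t) \<longrightarrow>
       (\<forall>s\<in>\<Omega>. \<forall>t\<in>\<Omega>. dist s t < d \<longrightarrow> \<bar>h s - h t\<bar> \<le> e) \<longrightarrow>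
       \<bar>(\<integral>t. indicator (E ps) t * (h t * f t) \<partial>\<mu>) - ev b h\<bar> \<le> e * (\<integral>t. indicator (E ps) t * \<bar>f t\<bar> \<partial>\<mu>)"
      by (elim exE conjE) (rule that)
    \<comment> \<open>The new cell: what the ball around p adds. All its points are within d of p,
      so replacing \<open>h t\<close> by \<open>h p\<close> on it changes \<open>h\<close> by at
      most e.\<close>
    define D where "D = (\<Omega> \<inter> ball p d) - E ps"
    have p: "p \<in> \<Omega>" using Cons.prems by simp
    have D_sets: "D \<in> sets \<mu>"
      unfolding D_def by (intro sets.Diff meas E_sets) auto
    have int: "integrable \<mu> (\<lambda>t. indicator A t * g t)" if "integrable \<mu> g" "A \<in> sets \<mu>" for A and g :: "'a \<Rightarrow> real"
      using integrable_mult_indicator[OF that(2,1)] by simp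
    have split: "(\<integral>t. indicator (E (p # ps)) t * g t \<partial>\<mu>)
        = (\<integral>t. indicator D t * g t \<partial>\<mu>) + (\<integral>t. indicator (E ps) t * g t \<partial>\<mu>)"
      if "integrable \<mu> g" for g :: "'a \<Rightarrow> real"
    proof -
      have "indicator (E (p # ps)) t * g t = indicator D t * g t + indicator (E ps) t * g t" for t
        by (auto simp: E_def D_def indicator_def)
      then show ?thesis
        using int[OF that D_sets] int[OF that E_sets] by simp
    qed
    define w where "w = (\<integral>t. indicator D t * f t \<partial>\<mu>)"
    have fa: "integrable \<mu> (\<lambda>t. \<bar>f t\<bar>)" using f by simp
    have w: "\<bar>w\<bar> \<le> (\<integral>t. indicator D t * \<bar>f t\<bar> \<partial>\<mu>)"
      unfolding w_def by (rule order_trans[OF integral_abs_bound]) (simp add: abs_mult)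
    show ?case
    proof (intro exI[of _ "(w, p) # b"] conjI allI impI)
      show "(w, p) # b \<in> lists (UNIV \<times> \<Omega>)" using b(1) p by simp
      show "(\<Sum>(w, s)\<leftarrow>(w, p) # b. \<bar>w\<bar>) \<le> (\<integral>t. indicator (E (p # ps)) t * \<bar>f t\<bar> \<partial>\<mu>)"
        using w b(2) by (simp add: split[OF fa])
    next
      fix h e
      assume h: "integrable \<mu> (\<lambda>t. h t * f t)"
        and e: "\<forall>s\<in>\<Omega>. \<forall>t\<in>\<Omega>. dist s t < d \<longrightarrow> \<bar>h s - h t\<bar> \<le> e"
      have "(\<integral>t. indicator D t * (h t * f t) \<partial>\<mu>) - w * h p
          = (\<integral>t. indicator D t * (h t * f t) - h p * (indicator D t * f t) \<partial>\<mu>)"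
        using int[OF h D_sets] int[OF f D_sets] by (simp add: w_def)
      also have "\<bar>\<dots>\<bar> \<le> (\<integral>t. \<bar>indicator D t * (h t * f t) - h p * (indicator D t * f t)\<bar> \<partial>\<mu>)"
        by (rule integral_abs_bound)
      also have "\<dots> \<le> (\<integral>t. e * (indicator D t * \<bar>f t\<bar>) \<partial>\<mu>)"
      proof (rule integral_mono)
        show "integrable \<mu> (\<lambda>t. \<bar>indicator D t * (h t * f t) - h p * (indicator D t * f t)\<bar>)"
          using int[OF h D_sets] int[OF f D_sets] by simp
        show "integrable \<mu> (\<lambda>t. e * (indicator D t * \<bar>f t\<bar>))"
          using int[OF fa D_sets] by simp
        fix t
        have "\<bar>h t - h p\<bar> * \<bar>f t\<bar> \<le> e * \<bar>f t\<bar>" if "t \<in> D"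
          using e p that by (intro mult_right_mono) (auto simp: D_def dist_commute)
        then show "\<bar>indicator D t * (h t * f t) - h p * (indicator D t * f t)\<bar> \<le> e * (indicator D t * \<bar>f t\<bar>)"
          by (auto simp: indicator_def simp flip: left_diff_distrib abs_mult)
      qed
      finally have "\<bar>(\<integral>t. indicator D t * (h t * f t) \<partial>\<mu>) - w * h p\<bar> \<le> e * (\<integral>t. indicator D t * \<bar>f t\<bar> \<partial>\<mu>)"
        by simp
      with b(3)[rule_format, OF h e[rule_format]]
      show "\<bar>(\<integral>t. indicator (E (p # ps)) t * (h t * f t) \<partial>\<mu>) - ev ((w, p) # b) h\<bar>
          \<le> e * (\<integral>t. indicator (E (p # ps)) t * \<bar>f t\<bar> \<partial>\<mu>)"
        by (simp add: split[OF h] split[OF fa] distrib_left abs_le_iff)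
    qed
  qed
  have "\<Omega> \<subseteq> (\<Union>p\<in>\<Omega>. ball p d)" using d by auto
  then obtain P where P: "P \<subseteq> \<Omega>" "finite P" "\<Omega> \<subseteq> (\<Union>p\<in>P. ball p d)"
    using compactE_image[OF compact, of \<Omega> "\<lambda>p. ball p d"] by (metis open_ball)
  obtain ps where ps: "set ps = P" using finite_list[OF P(2)] by blast
  have E: "E ps = \<Omega>" using P ps by (auto simp: E_def)
  have whole: "(\<integral>t. indicator \<Omega> t * g t \<partial>\<mu>) = (\<integral>t. g t \<partial>\<mu>)" for g :: "'a \<Rightarrow> real"
    by (rule Bochner_Integration.integral_cong) (auto simp: space_mu)
  show ?thesis
    using *[of ps] P(1) unfolding E ps whole by (elim meta_impE) (assumption, assumption)
qed

text \<open>
  Positive definiteness of \<open>k\<close> against the signed measure that is the sum of the point masses \<open>a\<close>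
  and of the density \<open>f\<close>.
\<close>

lemma mixed_gram_nonneg:
  assumes f: "f \<in> L2 \<mu>" and a: "a \<in> lists (UNIV \<times> \<Omega>)"
  shows "0 \<le> gram k a a + 2 * ev a (K f) + K f \<bullet>\<^sub>\<mu> f"
proof (rule ccontr)
  define n where "n = l1 f"
  define na where "na = (\<Sum>(w, s)\<leftarrow>a. \<bar>w\<bar>)"
  define S where "S = gram k a a + 2 * ev a (K f) + K f \<bullet>\<^sub>\<mu> f"
  assume "\<not> 0 \<le> gram k a a + 2 * ev a (K f) + K f \<bullet>\<^sub>\<mu> f"
  then have S: "S < 0" by (simp add: S_def)
  have fi: "integrable \<mu> f" by (rule L2_integrable[OF f])
  have n: "n \<ge> 0" by (simp add: n_def)
  have na: "na \<ge> 0" unfolding na_def by (rule sum_list_nonneg) auto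
  \<comment> \<open>The discretization error of the whole form is at most \<open>e * B\<close>, and
    e makes this half of -S. The summand 1 keeps \<open>B\<close> positive when \<open>f\<close> has
    zero L1 norm.\<close>
  define B where "B = 2 * n * na + 2 * n * n + 1"
  have B: "B > 0" using n na by (simp add: B_def add_nonneg_pos)
  define e where "e = - S / (2 * B)"
  have e: "e > 0" using S B by (simp add: e_def divide_neg_pos)
  obtain d where d: "d > 0"
    "\<And>s s' t. s \<in> \<Omega> \<Longrightarrow> s' \<in> \<Omega> \<Longrightarrow> t \<in> \<Omega> \<Longrightarrow> dist s s' < d \<Longrightarrow> \<bar>k s t - k s' t\<bar> \<le> e"
    using k_modulus[OF e] by blast
  obtain b where b: "b \<in> lists (UNIV \<times> \<Omega>)" "(\<Sum>(w, s)\<leftarrow>b. \<bar>w\<bar>) \<le> n"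
    "\<forall>h e. integrable \<mu> (\<lambda>t. h t * f t) \<longrightarrow>
       (\<forall>s\<in>\<Omega>. \<forall>t\<in>\<Omega>. dist s t < d \<longrightarrow> \<bar>h s - h t\<bar> \<le> e) \<longrightarrow>
       \<bar>(\<integral>t. h t * f t \<partial>\<mu>) - ev b h\<bar> \<le> e * n"
    using riemann_sum[OF fi d(1), folded n_def] by (elim exE conjE) (rule that)
  \<comment> \<open>The outer integral is discretized here, the inner one by fact 3 with
    \<open>c\<close> taken to be \<open>b\<close>. The test function \<open>K f\<close> has modulus
    \<open>e * n\<close>, whence the two factors n.\<close>
  have 1: "\<bar>K f \<bullet>\<^sub>\<mu> f - ev b (K f)\<bar> \<le> e * n * n"
    unfolding L2_inner_def
  proof (rule b(3)[rule_format])
    show "integrable \<mu> (\<lambda>t. K f t * f t)" by (rule L2_integrable_mult[OF K_L2[OF f] f])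
    show "\<bar>K f s - K f t\<bar> \<le> e * n" if "s \<in> \<Omega>" "t \<in> \<Omega>" "dist s t < d" for s t
      unfolding n_def using that d(2) by (intro K_modulus[OF fi]) auto
  qed
  have 2: "\<bar>K f s - ev b (k s)\<bar> \<le> e * n" if s: "s \<in> \<Omega>" for s
    unfolding K_eq[OF s]
  proof (rule b(3)[rule_format])
    show "integrable \<mu> (\<lambda>t. k s t * f t)" by (rule k_mult_integrable[OF s fi])
    show "\<bar>k s t - k s t'\<bar> \<le> e" if "t \<in> \<Omega>" "t' \<in> \<Omega>" "dist t t' < d" for t t'
      using d(2)[OF that(1,2) s that(3)] by (simp add: k_commute s that)
  qed
  have 3: "\<bar>ev c (K f) - gram k c b\<bar> \<le> e * n * (\<Sum>(w, s)\<leftarrow>c. \<bar>w\<bar>)" if "c \<in> lists (UNIV \<times> \<Omega>)" for c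
    unfolding gram_def ev_diff[symmetric] using that by (rule ev_abs_le) (rule 2)
  have "\<bar>ev b (K f) - gram k b b\<bar> \<le> e * n * n"
    by (rule order_trans[OF 3[OF b(1)]]) (use e n b(2) in \<open>intro mult_left_mono; simp\<close>)
  moreover have "\<bar>ev a (K f) - gram k a b\<bar> \<le> e * n * na"
    using 3[OF a] by (simp add: na_def)
  \<comment> \<open>Positivity for the finitely supported measure \<open>a @ b\<close>, the discrete
    counterpart of the mixed one.\<close>
  moreover have "0 \<le> gram k a a + 2 * gram k a b + gram k b b"
    using gram_nonneg[OF pos_k, of "a @ b"] gram_commute[OF sym_k a b(1)] a b(1) by simp
  ultimately have "- S \<le> 2 * (e * n * na) + 2 * (e * n * n)"
    using 1 unfolding S_def by (simp add: abs_le_iff)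
  also have "\<dots> \<le> e * B"
    using e by (simp add: B_def algebra_simps)
  also have "\<dots> = - S / 2"
    using B by (simp add: e_def)
  finally show False using S by simp
qed

lemma K_nonneg: "f \<in> L2 \<mu> \<Longrightarrow> 0 \<le> K f \<bullet>\<^sub>\<mu> f"
  using mixed_gram_nonneg[of f "[]"] by simp

end

section \<open>The resolvent\<close>

locale regularized_kernel_operator = kernel_operator +
  fixes c \<gamma> :: real
  assumes c_pos: "c > 0" and \<gamma>_pos: "\<gamma> > 0"
begin

abbreviation A where "A \<equiv> A_op \<mu> k c \<gamma>"

abbreviation Ai where "Ai \<equiv> A_inv \<mu> k c \<gamma>"

lemma A_apply: "A f t = c * K f t + \<gamma> * f t"
  by (simp add: A_op_def)

lemma A_L2: "f \<in> L2 \<mu> \<Longrightarrow> A f \<in> L2 \<mu>"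
  unfolding A_op_def by (intro L2_add L2_scale K_L2)

lemma A_add: "f \<in> L2 \<mu> \<Longrightarrow> g \<in> L2 \<mu> \<Longrightarrow> A (\<lambda>t. f t + g t) s = A f s + A g s"
  by (simp add: A_apply K_add algebra_simps)

lemma A_scale: "A (\<lambda>t. a * f t) s = a * A f s"
  by (simp add: A_apply K_scale algebra_simps)

lemma A_zero: "A (\<lambda>t. 0) s = 0"
  using A_scale[of 0] by simp

lemma inner_A: "f \<in> L2 \<mu> \<Longrightarrow> g \<in> L2 \<mu> \<Longrightarrow> A f \<bullet>\<^sub>\<mu> g = c * (K f \<bullet>\<^sub>\<mu> g) + \<gamma> * (f \<bullet>\<^sub>\<mu> g)"
  unfolding A_op_def by (simp add: L2_inner_add L2_inner_scale L2_scale K_L2)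

lemma A_self_adjoint: "f \<in> L2 \<mu> \<Longrightarrow> g \<in> L2 \<mu> \<Longrightarrow> A f \<bullet>\<^sub>\<mu> g = f \<bullet>\<^sub>\<mu> A g"
  using K_self_adjoint[of f g]
  by (simp add: inner_A L2_inner_commute[of _ f "A g"] L2_inner_commute[of _ f "K g"] L2_inner_commute[of _ f g])

lemma A_coercive: "f \<in> L2 \<mu> \<Longrightarrow> \<gamma> * (f \<bullet>\<^sub>\<mu> f) \<le> A f \<bullet>\<^sub>\<mu> f"
  using K_nonneg[of f] c_pos by (simp add: inner_A)

text \<open>The inner product is degenerate: a vanishing square does not make \<open>f\<close> the
  zero function. It does make the L1 norm vanish, so \<open>K f\<close> is zero at every point and
  only \<gamma> f survives.\<close>

lemma A_kernel:
  assumes f: "f \<in> L2 \<mu>" and 0: "A f \<bullet>\<^sub>\<mu> f = 0"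
  shows "A f s = \<gamma> * f s" and "f \<bullet>\<^sub>\<mu> f = 0"
proof -
  have "\<gamma> * (f \<bullet>\<^sub>\<mu> f) \<le> 0" using A_coercive[OF f] 0 by simp
  then show *: "f \<bullet>\<^sub>\<mu> f = 0"
    using L2_inner_self_nonneg[of \<mu> f] \<gamma>_pos by (simp add: mult_le_0_iff)
  then have "l1 f = 0" using l1_sq_le[OF f] by simp
  then have "K f s = 0" using K_bound[OF L2_integrable[OF f], of s] by simp
  then show "A f s = \<gamma> * f s" by (simp add: A_apply)
qed

text \<open>The difference d of two preimages satisfies A d = 0, hence by \<open>A_kernel\<close>
  also \<gamma> d = 0 at every point, not just almost everywhere.\<close>

lemma A_inj: "inj_on A (L2 \<mu>)"
proof (rule inj_onI)
  fix f g assume f: "f \<in> L2 \<mu>" and g: "g \<in> L2 \<mu>" and eq: "A f = A g"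
  let ?d = "\<lambda>t. f t + (- 1) * g t"
  have d: "?d \<in> L2 \<mu>" by (intro L2_add L2_scale f g)
  have 0: "A ?d s = 0" for s
    using A_add[OF f L2_scale[OF g, of "- 1"], of s] A_scale[of "- 1" g s] eq by simp
  then have "A ?d \<bullet>\<^sub>\<mu> ?d = 0" by (simp add: L2_inner_def)
  then have "\<gamma> * ?d s = 0" for s
    using A_kernel(1)[OF d, of s] 0[of s] by simp
  then show "f = g" using \<gamma>_pos by (intro ext) simp
qed

section \<open>Inversion of \<open>A\<close> by Richardson's iteration\<close>

lemma K_inner_K_le:
  assumes f: "f \<in> L2 \<mu>"
  shows "K f \<bullet>\<^sub>\<mu> K f \<le> (k_bound * mass)\<^sup>2 * (f \<bullet>\<^sub>\<mu> f)"
proof -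
  have "K f \<bullet>\<^sub>\<mu> K f \<le> (\<integral>t. (k_bound * l1 f)\<^sup>2 \<partial>\<mu>)"
    unfolding L2_inner_def
  proof (rule integral_mono)
    show "integrable \<mu> (\<lambda>t. K f t * K f t)" by (intro L2_integrable_mult K_L2 f)
    fix t
    have "\<bar>K f t\<bar>\<^sup>2 \<le> (k_bound * l1 f)\<^sup>2"
      by (intro power_mono K_bound L2_integrable f) auto
    then show "K f t * K f t \<le> (k_bound * l1 f)\<^sup>2" by (simp add: power2_eq_square)
  qed simp
  also have "\<dots> \<le> mass * (k_bound\<^sup>2 * (l1 f)\<^sup>2)"
    unfolding power_mult_distrib by (rule integral_const_le) simp
  also have "\<dots> \<le> mass * (k_bound\<^sup>2 * (mass * (f \<bullet>\<^sub>\<mu> f)))"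
    using mass_pos by (intro mult_left_mono l1_sq_le f) auto
  finally show ?thesis by (simp add: power2_eq_square mult_ac)
qed

text \<open>Bounds the squared operator norm of \<open>A\<close>, by |u + v|^2 <= 2 |u|^2 + 2 |v|^2
  for its two summands. Of the two factors \<open>mass\<close> in the square, one comes from
  estimating L1 by L2, the other from estimating L2 by the supremum.\<close>

definition A_bound :: real where "A_bound = 2 * (c * k_bound * mass)\<^sup>2 + 2 * \<gamma>\<^sup>2"

lemma A_bound_ge: "2 * \<gamma>\<^sup>2 \<le> A_bound" and A_bound_pos: "A_bound > 0"
  using \<gamma>_pos by (simp_all add: A_bound_def add_nonneg_pos)

lemma A_inner_A_le:
  assumes f: "f \<in> L2 \<mu>"
  shows "A f \<bullet>\<^sub>\<mu> A f \<le> A_bound * (f \<bullet>\<^sub>\<mu> f)"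
proof -
  let ?g = "\<lambda>t. c * K f t"
  have g: "?g \<in> L2 \<mu>" by (intro L2_scale K_L2 f)
  have "0 \<le> ?g \<bullet>\<^sub>\<mu> ?g + 2 * (- \<gamma>) * (?g \<bullet>\<^sub>\<mu> f) + (- \<gamma>)\<^sup>2 * (f \<bullet>\<^sub>\<mu> f)"
    unfolding L2_inner_add_self[OF g f, symmetric] by (rule L2_inner_self_nonneg)
  moreover have "A f \<bullet>\<^sub>\<mu> A f = ?g \<bullet>\<^sub>\<mu> ?g + 2 * \<gamma> * (?g \<bullet>\<^sub>\<mu> f) + \<gamma>\<^sup>2 * (f \<bullet>\<^sub>\<mu> f)"
    unfolding A_op_def by (rule L2_inner_add_self[OF g f])
  moreover have "?g \<bullet>\<^sub>\<mu> ?g \<le> (c * k_bound * mass)\<^sup>2 * (f \<bullet>\<^sub>\<mu> f)"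
    using mult_left_mono[OF K_inner_K_le[OF f], of "c\<^sup>2"]
    by (simp add: L2_inner_scale L2_inner_scale_right power2_eq_square mult_ac)
  ultimately show ?thesis
    by (simp add: A_bound_def algebra_simps)
qed

text \<open>Minimizer in \<omega> of 1 - 2 \<omega> \<gamma> + \<omega>^2 \<open>A_bound\<close>,
  which bounds the squared contraction factor of I - \<omega> A; the minimum is the square of
  \<open>rate\<close>.\<close>

definition relaxation :: real where "relaxation = \<gamma> / A_bound"

definition richardson :: "('a \<Rightarrow> real) \<Rightarrow> 'a \<Rightarrow> real" where
  "richardson d = (\<lambda>t. d t + (- relaxation) * A d t)"

definition rate :: real where "rate = sqrt (1 - \<gamma>\<^sup>2 / A_bound)"

lemma relaxation_pos: "relaxation > 0"
  using \<gamma>_pos A_bound_pos by (simp add: relaxation_def)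

lemma rate: "0 \<le> rate" "rate < 1" "rate\<^sup>2 = 1 - \<gamma>\<^sup>2 / A_bound"
proof -
  have "0 < \<gamma>\<^sup>2 / A_bound" "\<gamma>\<^sup>2 / A_bound \<le> 1"
    using A_bound_pos A_bound_ge \<gamma>_pos zero_le_power2[of \<gamma>] by (simp_all add: divide_le_eq)
  then show "0 \<le> rate" "rate < 1" "rate\<^sup>2 = 1 - \<gamma>\<^sup>2 / A_bound"
    by (auto simp: rate_def)
qed

lemma richardson_L2: "d \<in> L2 \<mu> \<Longrightarrow> richardson d \<in> L2 \<mu>"
  unfolding richardson_def by (intro L2_add L2_scale A_L2)

lemma richardson_contraction:
  assumes d: "d \<in> L2 \<mu>"
  shows "richardson d \<bullet>\<^sub>\<mu> richardson d \<le> rate\<^sup>2 * (d \<bullet>\<^sub>\<mu> d)"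
proof -
  have "richardson d \<bullet>\<^sub>\<mu> richardson d
    = d \<bullet>\<^sub>\<mu> d - 2 * relaxation * (A d \<bullet>\<^sub>\<mu> d) + relaxation\<^sup>2 * (A d \<bullet>\<^sub>\<mu> A d)"
    unfolding richardson_def L2_inner_add_self[OF d A_L2[OF d]]
    by (simp add: L2_inner_commute[of _ d "A d"])
  also have "\<dots> \<le> d \<bullet>\<^sub>\<mu> d - 2 * relaxation * (\<gamma> * (d \<bullet>\<^sub>\<mu> d)) + relaxation\<^sup>2 * (A_bound * (d \<bullet>\<^sub>\<mu> d))"
    using relaxation_pos
    by (intro add_mono diff_mono mult_left_mono A_coercive A_inner_A_le d) auto
  also have "\<dots> = rate\<^sup>2 * (d \<bullet>\<^sub>\<mu> d)"
    unfolding rate(3) relaxation_def using A_bound_pos by (simp add: field_simps power2_eq_square)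
  finally show ?thesis .
qed

text \<open>
  The errors \<open>d\<^sub>n\<close> of Richardson's iteration decay geometrically in the L2 norm, so the images under \<open>K\<close>
  of the partial sums \<open>g\<^sub>n\<close> converge uniformly to some \<open>h\<close>, and \<open>g = (f - c h) / \<gamma>\<close> solves \<open>A g = f\<close>.
  This uses completeness of the reals only, not of L2.
\<close>

lemma A_surj:
  assumes f: "f \<in> L2 \<mu>"
  shows "\<exists>g\<in>L2 \<mu>. A g = f"
proof -
  \<comment> \<open>Increments of the iteration sending g to g + \<open>relaxation\<close> (f - A
    g), started at 0; each is \<open>relaxation\<close> times the current residual.\<close>
  define d where "d n = (richardson ^^ n) (\<lambda>t. relaxation * f t)" for n
  have d: "d n \<in> L2 \<mu>" for n
    by (induction n) (auto simp: d_def intro: L2_scale f richardson_L2)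
  have d_Suc: "d (Suc n) t = d n t - relaxation * A (d n) t" for n t
    by (simp add: d_def richardson_def)
  have d_le: "d n \<bullet>\<^sub>\<mu> d n \<le> (rate ^ n)\<^sup>2 * (d 0 \<bullet>\<^sub>\<mu> d 0)" for n
  proof (induction n)
    case (Suc n)
    have "d (Suc n) \<bullet>\<^sub>\<mu> d (Suc n) \<le> rate\<^sup>2 * (d n \<bullet>\<^sub>\<mu> d n)"
      using richardson_contraction[OF d[of n]] by (simp add: d_def)
    also have "\<dots> \<le> rate\<^sup>2 * ((rate ^ n)\<^sup>2 * (d 0 \<bullet>\<^sub>\<mu> d 0))"
      by (intro mult_left_mono Suc.IH) auto
    finally show ?case by (simp add: power_mult_distrib mult.assoc)
  qed simp
  define C where "C = k_bound * sqrt (mass * (d 0 \<bullet>\<^sub>\<mu> d 0))"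
  have C: "C \<ge> 0" using k_bound_pos mass_pos by (simp add: C_def L2_inner_self_nonneg)
  have Kd: "\<bar>K (d n) s\<bar> \<le> C * rate ^ n" for n s
  proof -
    have "(l1 (d n))\<^sup>2 \<le> mass * ((rate ^ n)\<^sup>2 * (d 0 \<bullet>\<^sub>\<mu> d 0))"
      using l1_sq_le[OF d[of n]] mult_left_mono[OF d_le[of n], of mass] mass_pos by linarith
    then have "l1 (d n) \<le> sqrt (mass * ((rate ^ n)\<^sup>2 * (d 0 \<bullet>\<^sub>\<mu> d 0)))"
      by (rule real_le_rsqrt)
    also have "\<dots> = sqrt (mass * (d 0 \<bullet>\<^sub>\<mu> d 0)) * rate ^ n"
      using rate(1) by (simp add: real_sqrt_mult)
    finally have "k_bound * l1 (d n) \<le> C * rate ^ n"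
      using k_bound_pos by (simp add: C_def mult.assoc)
    then show ?thesis
      using K_bound[OF L2_integrable[OF d[of n]], of s] by linarith
  qed
  define G where "G n = (\<lambda>t. \<Sum>i<n. d i t)" for n
  have G: "G n \<in> L2 \<mu>" for n unfolding G_def by (intro L2_sum d)
  have G_Suc: "G (Suc n) = (\<lambda>t. G n t + d n t)" for n by (simp add: G_def)
  have K_G: "K (G n) s = (\<Sum>i<n. K (d i) s)" for n s
  proof (induction n)
    case 0
    then show ?case using K_scale[of 0] by (simp add: G_def)
  next
    case (Suc n)
    then show ?case by (simp add: G_Suc K_add[OF G d])
  qed
  have residual: "f t - A (G n) t = d n t / relaxation" for n t
  proof (induction n)
    case 0
    then show ?case using relaxation_pos by (simp add: G_def A_zero d_def)
  next
    case (Suc n)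
    then show ?case
      using relaxation_pos by (simp add: G_Suc A_add[OF G d] d_Suc diff_divide_distrib algebra_simps)
  qed
  define h where "h s = (\<Sum>n. K (d n) s)" for s
  have geom: "summable (\<lambda>i. C * rate ^ (i + n))" for n
    using rate by (intro summable_mult summable_ignore_initial_segment summable_geometric) auto
  have summable: "summable (\<lambda>n. K (d n) s)" for s
    using Kd by (intro summable_comparison_test'[OF geom[of 0]]) auto
  define B where "B = C / (1 - rate)"
  have h_tail: "\<bar>h s - K (G n) s\<bar> \<le> B * rate ^ n" for n s
  proof -
    have "h s - K (G n) s = (\<Sum>i. K (d (i + n)) s)"
      unfolding h_def K_G using suminf_split_initial_segment[OF summable, of s n] by simp
    also have "\<bar>\<dots>\<bar> \<le> (\<Sum>i. C * rate ^ (i + n))"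
      using norm_suminf_le[of "\<lambda>i. K (d (i + n)) s", OF _ geom] Kd by simp
    also have "\<dots> = (\<Sum>i. C * rate ^ n * rate ^ i)"
      by (simp add: power_add mult_ac)
    also have "\<dots> = C * rate ^ n * (1 / (1 - rate))"
      using rate by (subst suminf_mult) (auto simp: suminf_geometric summable_geometric)
    finally show ?thesis by (simp add: B_def)
  qed
  have h: "h \<in> L2 \<mu>"
  proof (rule L2_bounded)
    show "h \<in> borel_measurable \<mu>"
      unfolding h_def by (intro borel_measurable_suminf K_measurable L2_measurable d)
    show "\<bar>h s\<bar> \<le> B" for s using h_tail[of s 0] by (simp add: K_G)
    show "h s = 0" if "s \<notin> \<Omega>" for s using that by (simp add: h_def K_outside)
  qed
  define g where "g = (\<lambda>t. (1 / \<gamma>) * (f t + (- c) * h t))"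
  have g: "g \<in> L2 \<mu>" unfolding g_def by (intro L2_add L2_scale f h)
  define M where "M = (1 / (\<gamma> * relaxation)) * C + (c / \<gamma>) * (k_bound * (mass * B)) + B"
  have Kg_h: "\<bar>K g s - h s\<bar> \<le> M * rate ^ n" for s n
  proof -
    let ?e = "\<lambda>t. K (G n) t - h t"
    have e: "?e \<in> L2 \<mu>" by (intro L2_diff K_L2 G h)
    \<comment> \<open>The residual identity, solved for the distance from \<open>G n\<close> to
      \<open>g\<close>. Both error terms become uniformly small under \<open>K\<close>, the first by
      \<open>Kd\<close>, the second by the uniform tail bound; the summands of \<open>M\<close> are
      their constants and that of \<open>h_tail\<close>.\<close>
    have split: "g t = G n t + ((1 / (\<gamma> * relaxation)) * d n t + (c / \<gamma>) * ?e t)" for t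
    proof -
      have "\<gamma> * g t = f t - c * h t" using \<gamma>_pos by (simp add: g_def)
      also have "\<dots> = \<gamma> * G n t + d n t / relaxation + c * ?e t"
        using residual[of t n] by (simp add: A_apply algebra_simps)
      finally show ?thesis using \<gamma>_pos relaxation_pos by (simp add: field_simps)
    qed
    have "K g s = K (G n) s + ((1 / (\<gamma> * relaxation)) * K (d n) s + (c / \<gamma>) * K ?e s)"
      unfolding split[abs_def] by (simp only: K_add K_scale G d e L2_scale L2_add)
    moreover have "\<bar>(1 / (\<gamma> * relaxation)) * K (d n) s\<bar> \<le> (1 / (\<gamma> * relaxation)) * (C * rate ^ n)"
      unfolding abs_mult using \<gamma>_pos relaxation_pos Kd by (intro mult_mono) auto
    moreover have "\<bar>(c / \<gamma>) * K ?e s\<bar> \<le> (c / \<gamma>) * (k_bound * (mass * (B * rate ^ n)))"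
    proof -
      have "l1 ?e \<le> (\<integral>t. B * rate ^ n \<partial>\<mu>)"
      proof (rule integral_mono)
        show "integrable \<mu> (\<lambda>t. \<bar>?e t\<bar>)" by (intro integrable_abs L2_integrable e)
      qed (use h_tail in \<open>auto simp: abs_minus_commute\<close>)
      also have "\<dots> \<le> mass * (B * rate ^ n)"
        using C rate by (intro integral_const_le) (simp add: B_def)
      finally have "k_bound * l1 ?e \<le> k_bound * (mass * (B * rate ^ n))"
        using k_bound_pos by simp
      with K_bound[OF L2_integrable[OF e], of s]
      have "\<bar>K ?e s\<bar> \<le> k_bound * (mass * (B * rate ^ n))" by (rule order_trans)
      then show ?thesis
        unfolding abs_mult using c_pos \<gamma>_pos by (intro mult_mono) auto
    qed
    moreover have "M * rate ^ n = (1 / (\<gamma> * relaxation)) * (C * rate ^ n)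
        + (c / \<gamma>) * (k_bound * (mass * (B * rate ^ n))) + B * rate ^ n"
      by (simp add: M_def algebra_simps)
    moreover have "\<bar>a - b\<bar> \<le> m"
      if "a = a' + (y + z)" "\<bar>y\<bar> \<le> y'" "\<bar>z\<bar> \<le> z'" "m = y' + z' + b'" "\<bar>b - a'\<bar> \<le> b'"
      for a b m a' y z y' z' b' :: real
      using that by linarith
    ultimately show ?thesis
      using h_tail[of s n] by blast
  qed
  have "K g s = h s" for s
  proof -
    have "(\<lambda>n. M * rate ^ n) \<longlonglongrightarrow> M * 0"
      using rate by (intro tendsto_intros LIMSEQ_power_zero) auto
    then have "\<bar>K g s - h s\<bar> \<le> M * 0"
      using Kg_h by (intro LIMSEQ_le_const) auto
    then show ?thesis by simp
  qed
  then have "A g = f"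
    using \<gamma>_pos by (intro ext) (simp add: A_apply g_def)
  then show ?thesis using g by blast
qed

lemma Ai_L2: "f \<in> L2 \<mu> \<Longrightarrow> Ai f \<in> L2 \<mu>" and A_Ai: "f \<in> L2 \<mu> \<Longrightarrow> A (Ai f) = f"
proof -
  assume "f \<in> L2 \<mu>"
  then have "f \<in> A ` L2 \<mu>" using A_surj[of f] by force
  then show "Ai f \<in> L2 \<mu>" "A (Ai f) = f"
    unfolding A_inv_def by (rule inv_into_into, rule f_inv_into_f)
qed

lemma Ai_eqI: "g \<in> L2 \<mu> \<Longrightarrow> A g = f \<Longrightarrow> Ai f = g"
  unfolding A_inv_def by (rule inv_into_f_eq[OF A_inj])

lemma Ai_self_adjoint: "f \<in> L2 \<mu> \<Longrightarrow> g \<in> L2 \<mu> \<Longrightarrow> Ai f \<bullet>\<^sub>\<mu> g = f \<bullet>\<^sub>\<mu> Ai g"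
  using A_self_adjoint[of "Ai f" "Ai g"] by (simp add: Ai_L2 A_Ai)

section \<open>The kernel of the smoothing operator\<close>

text \<open>Cut off outside the domain because membership in \<open>L2\<close> demands it.\<close>

definition ksec :: "'a \<Rightarrow> 'a \<Rightarrow> real" where
  "ksec s = (\<lambda>t. if t \<in> \<Omega> then k s t else 0)"

text \<open>The kernel of \<open>K A\<^sup>-\<^sup>1 = (I - \<gamma> A\<^sup>-\<^sup>1) / c\<close>.\<close>

definition q :: "'a \<Rightarrow> 'a \<Rightarrow> real" where "q s = Ai (ksec s)"

lemma measurable_truncate:
  "f \<in> borel_measurable \<mu> \<Longrightarrow> (\<lambda>t. if t \<in> \<Omega> then f t else 0) \<in> borel_measurable \<mu>"
  for f :: "'a \<Rightarrow> real"
  by (rule measurable_cong[THEN iffD2]) (auto simp: space_mu)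

lemma ksec_L2: "s \<in> \<Omega> \<Longrightarrow> ksec s \<in> L2 \<mu>"
  unfolding ksec_def
  by (rule L2_bounded[where B = k_bound]) (auto simp: k_bound intro: measurable_truncate k_measurable)

lemma K_eq_inner: "s \<in> \<Omega> \<Longrightarrow> K f s = ksec s \<bullet>\<^sub>\<mu> f"
  unfolding K_eq L2_inner_def by (rule Bochner_Integration.integral_cong) (auto simp: ksec_def space_mu)

lemma q_L2: "s \<in> \<Omega> \<Longrightarrow> q s \<in> L2 \<mu>"
  by (simp add: q_def Ai_L2 ksec_L2)

lemma A_q: "s \<in> \<Omega> \<Longrightarrow> A (q s) = ksec s"
  by (simp add: q_def A_Ai ksec_L2)

lemma K_Ai: "s \<in> \<Omega> \<Longrightarrow> f \<in> L2 \<mu> \<Longrightarrow> K (Ai f) s = q s \<bullet>\<^sub>\<mu> f"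
  by (simp add: K_eq_inner Ai_self_adjoint[symmetric] ksec_L2 q_def)

lemma q_eq: "s \<in> \<Omega> \<Longrightarrow> t \<in> \<Omega> \<Longrightarrow> \<gamma> * q s t = k s t - c * K (q s) t"
  using fun_cong[OF A_q, of s t] by (simp add: A_apply ksec_def)

text \<open>Both terms on the right of \<open>q_eq\<close> are symmetric: K(q_s)(t) is the pairing
  of k_t = A q_t with q_s, and \<open>A\<close> is self-adjoint.\<close>

lemma q_commute: "s \<in> \<Omega> \<Longrightarrow> t \<in> \<Omega> \<Longrightarrow> q s t = q t s"
proof -
  assume st: "s \<in> \<Omega>" "t \<in> \<Omega>"
  have "K (q s) t = K (q t) s"
    using A_self_adjoint[OF q_L2 q_L2, of t s] st
    by (simp add: K_eq_inner A_q L2_inner_commute[of _ "q t"])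
  then have "\<gamma> * q s t = \<gamma> * q t s"
    using st by (simp add: q_eq k_commute)
  then show ?thesis using \<gamma>_pos by simp
qed

text \<open>Coercivity of \<open>A\<close> at q_s, with the mixed term absorbed by
  \<open>L2_inner_le\<close> at weight \<gamma>, gives |q_s| <= |k_s| / \<gamma> in L2. The bound is
  uniform in s, on which the joint continuity of \<open>q\<close> depends.\<close>

lemma l1_q_le:
  assumes s: "s \<in> \<Omega>"
  shows "l1 (q s) \<le> mass * k_bound / \<gamma>"
proof (rule power2_le_imp_le)
  have "\<gamma> * (q s \<bullet>\<^sub>\<mu> q s) \<le> ksec s \<bullet>\<^sub>\<mu> q s"
    using A_coercive[OF q_L2[OF s]] by (simp add: A_q s)
  moreover have "2 * (ksec s \<bullet>\<^sub>\<mu> q s) \<le> ksec s \<bullet>\<^sub>\<mu> ksec s / \<gamma> + \<gamma> * (q s \<bullet>\<^sub>\<mu> q s)"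
    by (intro L2_inner_le ksec_L2 q_L2 s \<gamma>_pos)
  ultimately have "\<gamma> * (q s \<bullet>\<^sub>\<mu> q s) \<le> ksec s \<bullet>\<^sub>\<mu> ksec s / \<gamma>" by linarith
  then have 1: "q s \<bullet>\<^sub>\<mu> q s \<le> ksec s \<bullet>\<^sub>\<mu> ksec s / \<gamma>\<^sup>2"
    using \<gamma>_pos by (simp add: field_simps power2_eq_square)
  have "ksec s \<bullet>\<^sub>\<mu> ksec s \<le> (\<integral>t. k_bound\<^sup>2 \<partial>\<mu>)"
    unfolding L2_inner_def
  proof (rule integral_mono)
    show "integrable \<mu> (\<lambda>t. ksec s t * ksec s t)" by (intro L2_integrable_mult ksec_L2 s)
    fix t assume "t \<in> space \<mu>"
    then have "\<bar>k s t\<bar>\<^sup>2 \<le> k_bound\<^sup>2"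
      using k_bound[OF s] by (intro power_mono) (auto simp: space_mu)
    then show "ksec s t * ksec s t \<le> k_bound\<^sup>2" by (simp add: ksec_def power2_eq_square)
  qed simp
  also have "\<dots> \<le> mass * k_bound\<^sup>2"
    by (rule integral_const_le) simp
  finally have "q s \<bullet>\<^sub>\<mu> q s \<le> mass * k_bound\<^sup>2 / \<gamma>\<^sup>2"
    using 1 by (meson divide_right_mono order_trans zero_le_power2)
  then have "mass * (q s \<bullet>\<^sub>\<mu> q s) \<le> mass * (mass * k_bound\<^sup>2 / \<gamma>\<^sup>2)"
    using mass_pos by (intro mult_left_mono) auto
  then show "(l1 (q s))\<^sup>2 \<le> (mass * k_bound / \<gamma>)\<^sup>2"
    using l1_sq_le[OF q_L2[OF s]] by (simp add: power2_eq_square mult_ac)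
  show "0 \<le> mass * k_bound / \<gamma>" using mass_pos k_bound_pos \<gamma>_pos by simp
qed

text \<open>Each q_s arises from a separate inversion of \<open>A\<close>, which says nothing about
  joint dependence on (s, t). By \<open>q_eq\<close>, q_s inherits a modulus of continuity from
  \<open>k\<close>, uniformly in s; symmetry transfers it to the first argument, and joint
  continuity gives measurability.\<close>

lemma q_measurable: "(\<lambda>(s, t). q s t) \<in> borel_measurable (\<mu> \<Otimes>\<^sub>M \<mu>)"
proof (rule continuous_on_measurable_pair, unfold continuous_on_iff, intro ballI allI impI)
  fix p e assume p: "p \<in> \<Omega> \<times> \<Omega>" and e: "0 < (e::real)"
  \<comment> \<open>\<open>e' * B\<close> bounds the variation of q_s when \<open>k\<close> varies
    by e': e' directly, plus c e' times the L1 norm of q_s through \<open>K\<close>, all divided by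
    \<gamma>.\<close>
  define B where "B = (1 + c * (mass * k_bound / \<gamma>)) / \<gamma>"
  have B: "B > 0" using c_pos mass_pos k_bound_pos \<gamma>_pos by (simp add: B_def add_pos_nonneg)
  define e' where "e' = e / (3 * B)"
  have e': "e' > 0" "e' * B = e / 3" using e B by (auto simp: e'_def)
  obtain d where d: "d > 0"
    "\<And>s s' t. s \<in> \<Omega> \<Longrightarrow> s' \<in> \<Omega> \<Longrightarrow> t \<in> \<Omega> \<Longrightarrow> dist s s' < d \<Longrightarrow> \<bar>k s t - k s' t\<bar> \<le> e'"
    using k_modulus[OF e'(1)] by blast
  have q: "\<bar>q s t - q s t'\<bar> \<le> e / 3" if s: "s \<in> \<Omega>" and t: "t \<in> \<Omega>" "t' \<in> \<Omega>" "dist t t' < d" for s t t'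
  proof -
    have 1: "\<bar>k t u - k t' u\<bar> \<le> e'" if "u \<in> \<Omega>" for u using d(2)[OF t(1,2) that t(3)] .
    have "\<bar>K (q s) t - K (q s) t'\<bar> \<le> e' * l1 (q s)"
      by (rule K_modulus[OF L2_integrable[OF q_L2[OF s]] t(1,2) 1])
    also have "\<dots> \<le> e' * (mass * k_bound / \<gamma>)"
      using e' by (intro mult_left_mono l1_q_le s) auto
    finally have "c * \<bar>K (q s) t - K (q s) t'\<bar> \<le> c * (e' * (mass * k_bound / \<gamma>))"
      using c_pos by (intro mult_left_mono) auto
    then have "\<bar>c * (K (q s) t - K (q s) t')\<bar> \<le> c * (e' * (mass * k_bound / \<gamma>))"
      using c_pos by (simp only: abs_mult abs_of_pos)
    moreover have "\<gamma> * (q s t - q s t') = (k t s - k t' s) - c * (K (q s) t - K (q s) t')"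
      using q_eq[OF s t(1)] q_eq[OF s t(2)] s t by (simp add: right_diff_distrib k_commute)
    ultimately have "\<bar>\<gamma> * (q s t - q s t')\<bar> \<le> e' + c * (e' * (mass * k_bound / \<gamma>))"
      using 1[OF s] by linarith
    also have "\<dots> = \<gamma> * (e' * B)"
      using \<gamma>_pos by (simp add: B_def field_simps)
    finally show ?thesis
      using \<gamma>_pos by (simp add: abs_mult e'(2))
  qed
  have "dist (case p' of (s, t) \<Rightarrow> q s t) (case p of (s, t) \<Rightarrow> q s t) < e"
    if p': "p' \<in> \<Omega> \<times> \<Omega>" "dist p' p < d" for p'
  proof -
    obtain s t s' t' where eq: "p = (s, t)" "p' = (s', t')" by (metis surj_pair)
    have st: "s \<in> \<Omega>" "t \<in> \<Omega>" "s' \<in> \<Omega>" "t' \<in> \<Omega>" using p p' eq by auto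
    have "dist s' s < d" "dist t' t < d"
      using dist_fst_le[of p' p] dist_snd_le[of p' p] p'(2) by (auto simp: eq)
    then have "\<bar>q s' t' - q s' t\<bar> \<le> e / 3" "\<bar>q t s' - q t s\<bar> \<le> e / 3"
      using st by (simp_all only: q)
    then have "\<bar>q s' t' - q s t\<bar> < e"
      using e q_commute[OF st(2,3)] q_commute[OF st(2,1)] by linarith
    then show ?thesis by (simp add: eq dist_real_def)
  qed
  then show "\<exists>d>0. \<forall>x'\<in>\<Omega> \<times> \<Omega>. dist x' p < d \<longrightarrow>
      dist (case x' of (s, t) \<Rightarrow> q s t) (case p of (s, t) \<Rightarrow> q s t) < e"
    using d(1) by blast
qed

section \<open>Positivity of the kernel \<open>q\<close>\<close>

lemma ev_L2:
  "a \<in> lists (UNIV \<times> \<Omega>) \<Longrightarrow> (\<And>s. s \<in> \<Omega> \<Longrightarrow> \<phi> s \<in> L2 \<mu>) \<Longrightarrow> (\<lambda>t. ev a (\<lambda>s. \<phi> s t)) \<in> L2 \<mu>"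
  by (induction a) (auto intro!: L2_add L2_scale L2_zero)

lemma inner_ev:
  "a \<in> lists (UNIV \<times> \<Omega>) \<Longrightarrow> (\<And>s. s \<in> \<Omega> \<Longrightarrow> \<phi> s \<in> L2 \<mu>) \<Longrightarrow> h \<in> L2 \<mu> \<Longrightarrow>
    (\<lambda>t. ev a (\<lambda>s. \<phi> s t)) \<bullet>\<^sub>\<mu> h = ev a (\<lambda>s. \<phi> s \<bullet>\<^sub>\<mu> h)"
proof (induction a)
  case (Cons p a)
  obtain w s where p: "p = (w, s)" by force
  have s: "\<phi> s \<in> L2 \<mu>" and a: "a \<in> lists (UNIV \<times> \<Omega>)" using Cons.prems p by auto
  show ?case
    using Cons.IH[OF a Cons.prems(2,3)] L2_inner_add[OF L2_scale[OF s, of w] ev_L2[of a \<phi>, OF a Cons.prems(2)] Cons.prems(3)]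
    by (simp add: p L2_inner_scale)
qed (simp add: L2_inner_def)

lemma A_ev:
  "a \<in> lists (UNIV \<times> \<Omega>) \<Longrightarrow> (\<And>s. s \<in> \<Omega> \<Longrightarrow> \<phi> s \<in> L2 \<mu>) \<Longrightarrow>
    A (\<lambda>t. ev a (\<lambda>s. \<phi> s t)) u = ev a (\<lambda>s. A (\<phi> s) u)"
proof (induction a)
  case (Cons p a)
  obtain w s where p: "p = (w, s)" by force
  have s: "\<phi> s \<in> L2 \<mu>" and a: "a \<in> lists (UNIV \<times> \<Omega>)" using Cons.prems p by auto
  show ?case
    using Cons.IH[OF a Cons.prems(2)] A_add[OF L2_scale[OF s, of w] ev_L2[of a \<phi>, OF a Cons.prems(2)]]
    by (simp add: p A_scale)
qed (simp add: A_zero)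

text \<open>The density -c g is the one for which the mixed measure has potential A g - c K g =
  \<gamma> g, where A g is the \<open>a\<close>-combination of the rows of \<open>k\<close>. Its
  energy is therefore \<gamma> times the integral of g against the mixed measure itself, that is
  \<gamma> (\<open>ev a g\<close> - c |g|^2).\<close>

lemma gram_q_nonneg:
  assumes a: "a \<in> lists (UNIV \<times> \<Omega>)"
  shows "0 \<le> gram q a a"
proof -
  define g where "g = (\<lambda>t. ev a (\<lambda>s. q s t))"
  have g: "g \<in> L2 \<mu>" unfolding g_def by (rule ev_L2[OF a q_L2])
  have A_g: "A g = (\<lambda>t. ev a (\<lambda>s. ksec s t))"
  proof
    fix t
    have "A g t = ev a (\<lambda>s. A (q s) t)" unfolding g_def using a q_L2 by (rule A_ev)
    also have "\<dots> = ev a (\<lambda>s. ksec s t)" by (rule ev_cong[OF a]) (simp add: A_q)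
    finally show "A g t = ev a (\<lambda>s. ksec s t)" .
  qed
  have gram: "gram q a a = ev a g"
    unfolding gram_def g_def by (rule ev_swap)
  have "ev a (A g) = gram k a a"
    unfolding A_g gram_def
    by (intro ev_cong[OF a]) (simp add: ksec_def k_commute)
  then have 1: "c * ev a (K g) + \<gamma> * ev a g = gram k a a"
    by (simp add: A_op_def ev_add ev_mult)
  have "ev a (K g) = ev a (\<lambda>s. ksec s \<bullet>\<^sub>\<mu> g)"
    by (rule ev_cong[OF a]) (simp add: K_eq_inner)
  also have "\<dots> = A g \<bullet>\<^sub>\<mu> g"
    unfolding A_g by (rule inner_ev[OF a ksec_L2 g, symmetric])
  finally have 2: "ev a (K g) = c * (K g \<bullet>\<^sub>\<mu> g) + \<gamma> * (g \<bullet>\<^sub>\<mu> g)"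
    by (simp add: inner_A g)
  have "K (\<lambda>t. (- c) * g t) = (\<lambda>s. (- c) * K g s)"
    by (rule ext) (rule K_scale)
  from mixed_gram_nonneg[OF L2_scale[OF g, of "- c"] a, unfolded this ev_mult L2_inner_scale L2_inner_scale_right]
  have "0 \<le> gram k a a - 2 * c * ev a (K g) + c\<^sup>2 * (K g \<bullet>\<^sub>\<mu> g)"
    by (simp add: power2_eq_square)
  also have "\<dots> = \<gamma> * ev a g - c * \<gamma> * (g \<bullet>\<^sub>\<mu> g)"
    unfolding 1[symmetric] unfolding 2 by (simp add: algebra_simps power2_eq_square)
  finally have "c * \<gamma> * (g \<bullet>\<^sub>\<mu> g) \<le> \<gamma> * ev a g" by simp
  moreover have "0 \<le> c * \<gamma> * (g \<bullet>\<^sub>\<mu> g)"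
    using c_pos \<gamma>_pos by (simp add: L2_inner_self_nonneg)
  ultimately have "0 \<le> \<gamma> * ev a g" by linarith
  then show ?thesis
    using \<gamma>_pos by (simp add: gram zero_le_mult_iff)
qed

end

section \<open>The kernel of the full operator\<close>

locale regularized_regression = regularized_kernel_operator \<mu> \<Omega> k c \<gamma>
  for \<mu> :: "'a::{metric_space, second_countable_topology} measure" and \<Omega> k c \<gamma> +
  fixes x :: "'p::finite \<Rightarrow> 'a \<Rightarrow> real"
  assumes cont_x: "\<And>j. continuous_on \<Omega> (x j)"
    and lin_indep: "\<And>\<beta> :: real ^ 'p. (\<forall>s\<in>\<Omega>. (\<Sum>j\<in>UNIV. \<beta> $ j * x j s) = 0) \<Longrightarrow> \<beta> = 0"
    and embeds: "\<And>\<beta> :: real ^ 'p. (AE s in \<mu>. (\<Sum>j\<in>UNIV. \<beta> $ j * x j s) = 0)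
                   \<Longrightarrow> \<forall>s\<in>\<Omega>. (\<Sum>j\<in>UNIV. \<beta> $ j * x j s) = 0"
begin

abbreviation X where "X \<equiv> X_op \<mu> x"

abbreviation M where "M \<equiv> XAX \<mu> k x c \<gamma>"

definition xt :: "'p \<Rightarrow> 'a \<Rightarrow> real" where
  "xt j = (\<lambda>s. if s \<in> \<Omega> then x j s else 0)"

definition u :: "'a \<Rightarrow> real ^ 'p" where
  "u s = (\<chi> j. Ai (xt j) s)"

lemma xt_L2: "xt j \<in> L2 \<mu>"
proof -
  have "bounded (x j ` \<Omega>)"
    by (intro compact_imp_bounded compact_continuous_image cont_x compact)
  then obtain B where "\<And>s. s \<in> \<Omega> \<Longrightarrow> \<bar>x j s\<bar> \<le> B" by (auto simp: bounded_iff)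
  then show ?thesis
    unfolding xt_def
    by (intro L2_bounded[where B = B] measurable_truncate continuous_on_measurable cont_x) auto
qed

lemma X_eq: "X \<beta> = (\<lambda>s. \<Sum>j\<in>UNIV. \<beta> $ j * xt j s)"
  by (auto simp: X_op_def space_mu xt_def)

lemma X_L2: "X \<beta> \<in> L2 \<mu>"
  unfolding X_eq by (intro L2_sum L2_scale xt_L2)

lemma X_adj_nth: "X_adj \<mu> x h $ j = h \<bullet>\<^sub>\<mu> xt j"
  by (auto simp: X_adj_def L2_inner_def xt_def space_mu intro!: Bochner_Integration.integral_cong)

lemma X_adj_adjoint:
  assumes h: "h \<in> L2 \<mu>"
  shows "\<beta> \<bullet> X_adj \<mu> x h = h \<bullet>\<^sub>\<mu> X \<beta>"
  unfolding X_eq L2_inner_sum_right[OF L2_scale[OF xt_L2] h]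
  by (simp add: inner_vec_def X_adj_nth L2_inner_scale_right)

lemma A_sum:
  assumes "finite J" "\<And>j. j \<in> J \<Longrightarrow> f j \<in> L2 \<mu>"
  shows "A (\<lambda>s. \<Sum>j\<in>J. w j * f j s) t = (\<Sum>j\<in>J. w j * A (f j) t)"
  using assms
proof (induction J)
  case (insert j J)
  have "A (\<lambda>s. w j * f j s + (\<Sum>j\<in>J. w j * f j s)) t
      = A (\<lambda>s. w j * f j s) t + A (\<lambda>s. \<Sum>j\<in>J. w j * f j s) t"
    using insert.prems by (intro A_add L2_scale L2_sum) auto
  then show ?case using insert by (simp add: A_scale)
qed (simp add: A_zero)

text \<open>Linearity of the inverse on the span of the \<open>xt j\<close>, from uniqueness of the
  preimage.\<close>

lemma Ai_X: "Ai (X \<beta>) s = u s \<bullet> \<beta>"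
proof -
  have "Ai (X \<beta>) = (\<lambda>s. \<Sum>j\<in>UNIV. \<beta> $ j * Ai (xt j) s)"
  proof (rule Ai_eqI)
    show "(\<lambda>s. \<Sum>j\<in>UNIV. \<beta> $ j * Ai (xt j) s) \<in> L2 \<mu>"
      by (intro L2_sum L2_scale Ai_L2 xt_L2)
    show "A (\<lambda>s. \<Sum>j\<in>UNIV. \<beta> $ j * Ai (xt j) s) = X \<beta>"
      by (intro ext) (simp add: A_sum Ai_L2 xt_L2 A_Ai X_eq)
  qed
  then show ?thesis by (simp add: u_def inner_vec_def mult.commute)
qed

section \<open>The finite-dimensional operator \<open>M\<close> and its inverse\<close>

lemma inner_M: "\<beta> \<bullet> M \<beta>' = Ai (X \<beta>') \<bullet>\<^sub>\<mu> X \<beta>"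
  unfolding XAX_def by (rule X_adj_adjoint[OF Ai_L2[OF X_L2]])

lemma M_commute: "\<beta> \<bullet> M \<beta>' = M \<beta> \<bullet> \<beta>'"
  unfolding inner_M inner_commute[of "M \<beta>"]
  using Ai_self_adjoint[OF X_L2 X_L2, of \<beta>' \<beta>] by (simp add: L2_inner_commute)

lemma M_nonneg: "0 \<le> \<beta> \<bullet> M \<beta>"
proof -
  have "0 \<le> \<gamma> * (Ai (X \<beta>) \<bullet>\<^sub>\<mu> Ai (X \<beta>))"
    using \<gamma>_pos by (simp add: L2_inner_self_nonneg)
  also have "\<dots> \<le> Ai (X \<beta>) \<bullet>\<^sub>\<mu> X \<beta>"
    using A_coercive[OF Ai_L2[OF X_L2]] by (simp add: A_Ai X_L2 L2_inner_commute)
  finally show ?thesis by (simp add: inner_M)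
qed

text \<open>Self-adjointness forces linearity: each inner product with the value of \<open>M\<close>
  equals one in which the argument itself stands in a linear slot.\<close>

lemma M_linear: "linear M"
proof (rule linearI)
  fix \<beta> \<beta>' r
  have "M (\<beta> + \<beta>') \<bullet> z = (M \<beta> + M \<beta>') \<bullet> z" for z
    by (simp only: M_commute[symmetric] inner_add_left)
  then show "M (\<beta> + \<beta>') = M \<beta> + M \<beta>'" by (rule vector_eq_rdot[THEN iffD1, OF allI])
  have "M (r *\<^sub>R \<beta>) \<bullet> z = (r *\<^sub>R M \<beta>) \<bullet> z" for z
    by (simp only: M_commute[symmetric] inner_scaleR_left)
  then show "M (r *\<^sub>R \<beta>) = r *\<^sub>R M \<beta>" by (rule vector_eq_rdot[THEN iffD1, OF allI])
qed

text \<open>With g = A^-1 X \<beta> the hypothesis makes the form of \<open>A\<close> vanish at g,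
  so g is null and X \<beta> = \<gamma> g at every point. Thus X \<beta> vanishes almost everywhere;
  \<open>embeds\<close> makes this everywhere, and linear independence finishes.\<close>

lemma M_kernel:
  assumes "M \<beta> = 0"
  shows "\<beta> = 0"
proof -
  define g where "g = Ai (X \<beta>)"
  have g: "g \<in> L2 \<mu>" and A_g: "A g = X \<beta>" by (simp_all add: g_def Ai_L2 A_Ai X_L2)
  have "g \<bullet>\<^sub>\<mu> X \<beta> = 0" using assms inner_M[of \<beta> \<beta>] by (simp add: g_def)
  then have 0: "A g \<bullet>\<^sub>\<mu> g = 0" by (simp add: A_g L2_inner_commute[of _ "X \<beta>"])
  have "AE t in \<mu>. g t * g t = 0"
    using A_kernel(2)[OF g 0] L2_integrable_mult[OF g g]
    by (subst (asm) L2_inner_def) (simp add: integral_nonneg_eq_0_iff_AE)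
  moreover have "(\<Sum>j\<in>UNIV. \<beta> $ j * x j t) = \<gamma> * g t" if "t \<in> \<Omega>" for t
    using A_kernel(1)[OF g 0, of t] that by (simp add: A_g X_op_def space_mu)
  ultimately have "AE t in \<mu>. (\<Sum>j\<in>UNIV. \<beta> $ j * x j t) = 0"
    by (auto simp: space_mu)
  from lin_indep[OF embeds[OF this]] show ?thesis .
qed

lemma M_inv: "M (inv M y) = y"
proof -
  have "inj M" using M_kernel by (simp add: linear_injective_0[OF M_linear])
  then have "surj M" by (rule linear_injective_imp_surjective[OF M_linear _ refl])
  then show ?thesis by (rule surj_f_inv_f)
qed

lemma inv_M_commute: "y \<bullet> inv M z = inv M y \<bullet> z"
  using M_commute[of "inv M y" "inv M z"] by (simp add: M_inv)

lemma inv_M_nonneg: "0 \<le> y \<bullet> inv M y"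
  using M_nonneg[of "inv M y"] by (simp add: M_inv inner_commute)

section \<open>The kernel \<open>r_inf\<close> and the operator it represents\<close>

definition r_inf :: "'a \<Rightarrow> 'a \<Rightarrow> real" where
  "r_inf s t = q s t + \<gamma> / c * (u s \<bullet> inv M (u t))"

lemma r_inf_symmetric: "symmetric_kernel_on \<Omega> r_inf"
  unfolding symmetric_kernel_on_def
proof (intro ballI)
  fix s t assume "s \<in> \<Omega>" "t \<in> \<Omega>"
  moreover have "u s \<bullet> inv M (u t) = u t \<bullet> inv M (u s)"
    by (rule trans[OF inv_M_commute inner_commute])
  ultimately show "r_inf s t = r_inf t s"
    by (simp add: r_inf_def q_commute[of s t])
qed

lemma r_inf_pos_def: "pos_def_kernel_on \<Omega> r_inf"
proof (rule pos_def_kernel_onI)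
  fix a :: "(real \<times> 'a) list" assume a: "a \<in> lists (UNIV \<times> \<Omega>)"
  have "gram r_inf a a = gram q a a + \<gamma> / c * gram (\<lambda>s t. u s \<bullet> inv M (u t)) a a"
    by (simp only: gram_def r_inf_def[abs_def] ev_add ev_mult)
  moreover have "0 \<le> gram (\<lambda>s t. u s \<bullet> inv M (u t)) a a"
    by (rule gram_inner_nonneg[OF inv_M_commute inv_M_nonneg])
  ultimately show "0 \<le> gram r_inf a a"
    using gram_q_nonneg[OF a] c_pos \<gamma>_pos by simp
qed

lemma u_measurable: "(\<lambda>s. u s $ j) \<in> borel_measurable \<mu>"
  by (simp add: u_def L2_measurable Ai_L2 xt_L2)

lemma r_inf_measurable: "(\<lambda>(s, t). r_inf s t) \<in> borel_measurable (\<mu> \<Otimes>\<^sub>M \<mu>)"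
proof -
  \<comment> \<open>Self-adjointness of \<open>inv M\<close> turns the coordinates of
    \<open>inv M (u t)\<close> into fixed linear combinations of those of \<open>u t\<close>, so the
    second summand becomes a finite sum of products of measurable functions.\<close>
  have "u s \<bullet> inv M (u t) = (\<Sum>i\<in>UNIV. u s $ i * (\<Sum>j\<in>UNIV. inv M (axis i 1) $ j * u t $ j))" for s t
  proof -
    have "inv M (u t) $ i = inv M (axis i 1) \<bullet> u t" for i
      using inv_M_commute[of "axis i 1" "u t"] by (simp add: inner_axis')
    then show ?thesis by (simp add: inner_vec_def)
  qed
  then have eq: "(\<lambda>(s, t). r_inf s t) = (\<lambda>p. (case p of (s, t) \<Rightarrow> q s t) + \<gamma> / c *
      (\<Sum>i\<in>UNIV. u (fst p) $ i * (\<Sum>j\<in>UNIV. inv M (axis i 1) $ j * u (snd p) $ j)))"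
    by (simp add: r_inf_def fun_eq_iff)
  show ?thesis
    unfolding eq
    by (intro borel_measurable_add borel_measurable_times borel_measurable_sum borel_measurable_const
        q_measurable measurable_compose[OF measurable_fst u_measurable]
        measurable_compose[OF measurable_snd u_measurable])
qed

text \<open>The summand \<open>q\<close> yields K A^-1 f, since q_s pairs with f as k_s does with
  A^-1 f. The other summand collects the pairings of A^-1 x_j with f, which by self-adjointness are
  the coordinates of X^* A^-1 f.\<close>

lemma R_inf_eq:
  assumes f: "f \<in> L2 \<mu>" and s: "s \<in> \<Omega>"
  shows "integrable \<mu> (\<lambda>t. r_inf s t * f t)"
    and "R_inf \<mu> k x c \<gamma> f s = (\<integral>t. r_inf s t * f t \<partial>\<mu>)"
proof -
  let ?N = "inv M" and ?g = "Ai f"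
  have g: "?g \<in> L2 \<mu>" by (rule Ai_L2[OF f])
  have r: "r_inf s t * f t = q s t * f t + \<gamma> / c * (\<Sum>j\<in>UNIV. ?N (u s) $ j * (Ai (xt j) t * f t))" for t
  proof -
    have "?N (u s) \<bullet> u t = (\<Sum>j\<in>UNIV. ?N (u s) $ j * Ai (xt j) t)"
      by (simp add: inner_vec_def u_def[of t])
    then show ?thesis
      unfolding r_inf_def inv_M_commute by (simp only: distrib_right sum_distrib_right mult.assoc)
  qed
  have i: "integrable \<mu> (\<lambda>t. q s t * f t)" "integrable \<mu> (\<lambda>t. Ai (xt j) t * f t)" for j
    using f s by (auto intro: L2_integrable_mult q_L2 Ai_L2 xt_L2)
  show "integrable \<mu> (\<lambda>t. r_inf s t * f t)"
    unfolding r using i by simp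
  have "(\<integral>t. r_inf s t * f t \<partial>\<mu>) = q s \<bullet>\<^sub>\<mu> f + \<gamma> / c * (\<Sum>j\<in>UNIV. ?N (u s) $ j * (Ai (xt j) \<bullet>\<^sub>\<mu> f))"
    unfolding r L2_inner_def using i by simp
  also have "(\<Sum>j\<in>UNIV. ?N (u s) $ j * (Ai (xt j) \<bullet>\<^sub>\<mu> f)) = ?N (u s) \<bullet> X_adj \<mu> x ?g"
    by (simp add: inner_vec_def X_adj_nth Ai_self_adjoint f xt_L2 L2_inner_commute[of _ _ ?g])
  also have "\<dots> = Ai (X (?N (X_adj \<mu> x ?g))) s"
    by (simp add: Ai_X inv_M_commute)
  also have "q s \<bullet>\<^sub>\<mu> f = K ?g s" by (rule K_Ai[OF s f, symmetric])
  finally have "(\<integral>t. r_inf s t * f t \<partial>\<mu>) = K ?g s + \<gamma> / c * Ai (X (?N (X_adj \<mu> x ?g))) s" .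
  \<comment> \<open>A A^-1 f = f read at s; it identifies (f - \<gamma> A^-1 f) / c with K A^-1
    f.\<close>
  moreover have "f s = c * K ?g s + \<gamma> * ?g s"
    using fun_cong[OF A_Ai[OF f], of s] by (simp add: A_apply)
  ultimately show "R_inf \<mu> k x c \<gamma> f s = (\<integral>t. r_inf s t * f t \<partial>\<mu>)"
    using c_pos by (simp add: R_inf_def field_simps)
qed

lemma R_inf_outside: "f \<in> L2 \<mu> \<Longrightarrow> s \<notin> \<Omega> \<Longrightarrow> R_inf \<mu> k x c \<gamma> f s = 0"
  by (simp add: R_inf_def L2_outside[where M = \<mu>] Ai_L2 X_L2 space_mu)

theorem is_integral_operator_R_inf: "is_integral_operator \<mu> r_inf (R_inf \<mu> k x c \<gamma>)"
  unfolding is_integral_operator_def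
  by (auto simp: r_inf_measurable R_inf_eq R_inf_outside integral_op_def space_mu)

end

theorem proposition2p1:
  fixes \<Omega> :: "'a::{metric_space, second_countable_topology} set"
    and \<mu> :: "'a measure"
    and k :: "'a \<Rightarrow> 'a \<Rightarrow> real"
    and x :: "'p::finite \<Rightarrow> 'a \<Rightarrow> real"
    and c \<gamma> :: real
  assumes "c > 0" and "\<gamma> > 0"
    and "compact \<Omega>"
    and "sets \<mu> = sets (restrict_space borel \<Omega>)"
    and "finite_measure \<mu>"
    and "continuous_on (\<Omega> \<times> \<Omega>) (\<lambda>(s, t). k s t)"
    and "symmetric_kernel_on \<Omega> k"
    and "pos_def_kernel_on \<Omega> k"
    and "\<And>j. continuous_on \<Omega> (x j)"
    and lin_indep: "\<And>\<beta> :: real ^ 'p. (\<forall>s\<in>\<Omega>. (\<Sum>j\<in>UNIV. \<beta> $ j * x j s) = 0) \<Longrightarrow> \<beta> = 0"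
    \<comment> \<open>the inclusion of continuous functions into L2, tacit in the formation of
        \<open>(X\<^sup>* A\<^sup>-\<^sup>1 X)\<^sup>-\<^sup>1\<close>, is injective on the span of the \<open>x j\<close>; automatic if \<open>\<mu>\<close> has full support\<close>
    and embeds: "\<And>\<beta> :: real ^ 'p. (AE s in \<mu>. (\<Sum>j\<in>UNIV. \<beta> $ j * x j s) = 0)
                   \<Longrightarrow> \<forall>s\<in>\<Omega>. (\<Sum>j\<in>UNIV. \<beta> $ j * x j s) = 0"
  shows "\<exists>r H ip. is_RKHS \<Omega> H ip r \<and> is_integral_operator \<mu> r (R_inf \<mu> k x c \<gamma>)"
proof -
  interpret regularized_regression \<mu> \<Omega> k c \<gamma> x
    by (intro regularized_regression.intro regularized_kernel_operator.intro kernel_operator.intro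
        kernel_operator_axioms.intro regularized_kernel_operator_axioms.intro
        regularized_regression_axioms.intro) (fact assms)+
  interpret R: pos_def_kernel \<Omega> r_inf
    by unfold_locales (rule r_inf_symmetric r_inf_pos_def)+
  show ?thesis
    using R.is_RKHS_rkhs is_integral_operator_R_inf by blast
qed

end
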